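(* Let $p\ge 2$, $n>p$, and let $\mathbf X_1,\dots,\mathbf X_n$ be i.i.d. $N_p(\boldsymbol\theta,\boldsymbol\Sigma)$ with $\boldsymbol\Sigma\in\mathcal M$ unknown. Let $\mathcal C$ be either the positive orthant $\mathcal O_p^+$ or the half-space $\mathcal H_p^*$, and let $0<\alpha<1$. For the problem of testing $H_0:\boldsymbol\theta=\mathbf 0$ against $H_1:\boldsymbol\theta\in\mathcal C\setminus\{\mathbf 0\}$, the level-$\alpha$ likelihood ratio test (LRT) is not a proper Bayes test.
   Context: $\mathcal M$ is the set of all $p\times p$ real symmetric positive definite matrices; $\mathcal O_p^+=\{\boldsymbol\theta\in\mathbb R^p:\boldsymbol\theta\ge\mathbf 0\text{ componentwise}\}$; $\mathcal H_p^*=\{\boldsymbol\theta\in\mathbb R^p:\theta_p\ge 0\}$. $\bar{\mathbf X}_n=n^{-1}\sum_i\mathbf X_i$ and $\mathbf S_n=\sum_i(\mathbf X_i-\bar{\mathbf X}_n)(\mathbf X_i-\bar{\mathbf X}_n)'$, which is positive definite with probability one. LRT: for positive definite $\mathbf A$, let $\langle\mathbf x,\mathbf y\rangle_{\mathbf A}=\mathbf x'\mathbf A^{-1}\mathbf y$ with norm $\|\cdot\|_{\mathbf A}$, and let $\pi_{\mathbf A}(\mathbf x;\mathcal C)$ be the orthogonal projection of $\mathbf x$ onto $\mathcal C$ for this inner product. The LRT statistic is $$L_{\mathcal C}=\frac{\|\pi_{\mathbf S_n}(n^{1/2}\bar{\mathbf X}_n;\mathcal C)\|^2_{\mathbf S_n}}{1+\|n^{1/2}\bar{\mathbf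 X}_n-\pi_{\mathbf S_n}(n^{1/2}\bar{\mathbf X}_n;\mathcal C)\|^2_{\mathbf S_n}}.$$ The level-$\alpha$ LRT has acceptance region $\{L_{\mathcal C}\le l_\alpha\}$, where $l_\alpha>0$ satisfies $\sup_{\boldsymbol\Sigma\in\mathcal M}P_{\mathbf 0,\boldsymbol\Sigma}\{L_{\mathcal C}\ge l_\alpha\}=\alpha$. Proper Bayes test: let $f(\cdot\mid\boldsymbol\theta,\boldsymbol\Sigma)$ be the joint density of $\mathbf X_1,\dots,\mathbf X_n$. A test is a proper Bayes test if there are a probability measure $G_0$ on $\{\mathbf 0\}\times\mathcal M$, a probability measure $G_1$ on $(\mathcal C\setminus\{\mathbf 0\})\times\mathcal M$ and a constant $c\in(0,\infty)$ such that, up to Lebesgue-null sets, the test rejects $H_0$ where $\int f\,dG_1>c\int f\,dG_0$ and accepts $H_0$ where $\int f\,dG_1<c\int f\,dG_0$. *)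

theory Defs
  imports "HOL-Probability.Probability"
begin

definition spd_matrices :: "(real^'p^'p) set" where
  "spd_matrices = {A. transpose A = A \<and> (\<forall>v. v \<noteq> 0 \<longrightarrow> v \<bullet> (A *v v) > 0)}"

definition pos_orthant :: "(real^'p) set" where
  "pos_orthant = {\<theta>. \<forall>i. \<theta> $ i \<ge> 0}"

(* The index type carries no order; k plays the role of the last coordinate. *)
definition half_space :: "'p::finite \<Rightarrow> (real^'p) set" where
  "half_space k = {\<theta>. \<theta> $ k \<ge> 0}"

definition mvn_density :: "real^'p \<Rightarrow> real^'p^'p \<Rightarrow> real^'p \<Rightarrow> real" where
  "mvn_density \<theta> \<Sigma> v =
     exp (- ((v - \<theta>) \<bullet> (matrix_inv \<Sigma> *v (v - \<theta>))) / 2)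
       / sqrt ((2 * pi) ^ CARD('p) * det \<Sigma>)"

(* A sample is x :: real^'p^'n, with x $ i the i-th observation; lborel on this type
   is the Lebesgue measure on R^(np). *)
definition sample_density :: "real^'p \<Rightarrow> real^'p^'p \<Rightarrow> real^'p^'n \<Rightarrow> real" where
  "sample_density \<theta> \<Sigma> x = (\<Prod>i\<in>UNIV. mvn_density \<theta> \<Sigma> (x $ i))"

definition sample_law :: "real^'p \<Rightarrow> real^'p^'p \<Rightarrow> (real^'p^'n) measure" where
  "sample_law \<theta> \<Sigma> = density lborel (\<lambda>x. ennreal (sample_density \<theta> \<Sigma> x))"

definition sample_mean :: "real^'p^'n \<Rightarrow> real^'p" where
  "sample_mean x = (1 / real CARD('n)) *\<^sub>R (\<Sum>i\<in>UNIV. x $ i)"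

definition scatter_matrix :: "real^'p^'n \<Rightarrow> real^'p^'p" where
  "scatter_matrix x =
     (\<Sum>i\<in>UNIV. \<chi> a b. (x $ i - sample_mean x) $ a * (x $ i - sample_mean x) $ b)"

definition inner_wrt :: "real^'p^'p \<Rightarrow> real^'p \<Rightarrow> real^'p \<Rightarrow> real" where
  "inner_wrt A u v = u \<bullet> (matrix_inv A *v v)"

definition norm_wrt :: "real^'p^'p \<Rightarrow> real^'p \<Rightarrow> real" where
  "norm_wrt A v = sqrt (inner_wrt A v v)"

(* Nearest point of C; it exists and is unique for A positive definite and C nonempty,
   closed and convex. *)
definition proj_wrt :: "real^'p^'p \<Rightarrow> real^'p \<Rightarrow> (real^'p) set \<Rightarrow> real^'p" where
  "proj_wrt A v C =
     (THE y. y \<in> C \<and> (\<forall>z\<in>C. norm_wrt A (v - y) \<le> norm_wrt A (v - z)))"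

(* The value 0 off the event that the scatter matrix is positive definite is a convention
   on a Lebesgue-null set (for sample size larger than the dimension). *)
definition lrt_stat :: "(real^'p) set \<Rightarrow> real^'p^'n \<Rightarrow> real" where
  "lrt_stat C x =
     (let S = scatter_matrix x;
          y = sqrt (real CARD('n)) *\<^sub>R sample_mean x;
          z = proj_wrt S y C
      in if S \<in> spd_matrices
         then (norm_wrt S z)\<^sup>2 / (1 + (norm_wrt S (y - z))\<^sup>2)
         else 0)"

definition prob_measure_on :: "'a::topological_space set \<Rightarrow> 'a measure \<Rightarrow> bool" where
  "prob_measure_on T G \<longleftrightarrow> prob_space G \<and> sets G = sets (restrict_space borel T)"

(* The marginal densities are extended nonnegative integrals: a mixture may be infinite
   on a Lebesgue-null set of samples. *)
definition marginal_density ::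
    "((real^'p) \<times> (real^'p^'p)) measure \<Rightarrow> real^'p^'n \<Rightarrow> ennreal" where
  "marginal_density G x = (\<integral>\<^sup>+ (\<theta>, \<Sigma>). ennreal (sample_density \<theta> \<Sigma> x) \<partial>G)"

(* acc is the acceptance region of the test of theta = 0 against theta in C - {0}. *)
definition proper_bayes_test :: "(real^'p) set \<Rightarrow> (real^'p^'n) set \<Rightarrow> bool" where
  "proper_bayes_test C acc \<longleftrightarrow>
     (\<exists>G0 G1. \<exists>c::real.
        prob_measure_on ({0} \<times> spd_matrices) G0 \<and>
        prob_measure_on ((C - {0}) \<times> spd_matrices) G1 \<and>
        c > 0 \<and>
        (AE x in lborel.
           (marginal_density G1 x > ennreal c * marginal_density G0 x \<longrightarrow> x \<notin> acc) \<and>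
           (marginal_density G1 x < ennreal c * marginal_density G0 x \<longrightarrow> x \<in> acc)))"

end

theory Submission
  imports Defs
begin

text \<open>Let \<open>y = \<surd>n \<cdot> mean\<close> and \<open>V = \<Sum>\<^sub>i x\<^sub>i x\<^sub>i\<^sup>T\<close>. On the samples with \<open>V = I\<close>, \<open>|y| < 1\<close>, the null mixture is
  constant and the alternative mixture is a Laplace transform \<open>F(y) = \<integral> h e\<^bsup>\<eta>\<cdot>y\<^esup>\<close> with
  \<open>\<eta> = \<surd>n \<Sigma>\<^sup>-\<^sup>1\<theta>\<close>, so for a proper Bayes test \<open>F\<close> is constant on the boundary of the acceptance region and
  at most that constant inside. In the coordinates \<open>(u, v) = (y\<^sub>j, y\<^sub>k)\<close>, \<open>u \<ge> 0\<close>, the LRT boundary is the circle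
  \<open>u\<^sup>2 + v\<^sup>2 = r\<^sup>2 = l / (1 + l)\<close> for \<open>v \<ge> 0\<close>, but the larger ellipse \<open>u\<^sup>2 + r\<^sup>2 v\<^sup>2 = r\<^sup>2\<close> for \<open>v \<le> 0\<close>.
  These meet at \<open>(r, 0)\<close> with different curvatures. Since \<open>F\<close> is smooth, continuing the circle by an angle \<open>t\<close>
  into \<open>v < 0\<close> changes \<open>F\<close> by \<open>O(t\<^sup>3)\<close> only; but there the circle lies at depth of order \<open>t\<^sup>2\<close> inside the region
  \<open>F \<le> const\<close>, and convexity of \<open>F\<close> would force a drop of order \<open>t\<^sup>2\<close> unless \<open>\<eta>\<^sub>j = 0\<close> almost surely. Then
  \<open>\<eta>\<^sub>k = 0\<close> as well, hence \<open>\<theta> = 0\<close>, which the prior on the alternative excludes.\<close>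

section \<open>Positive definite matrices\<close>

lemma spd_symmetric: "A \<in> spd_matrices \<Longrightarrow> transpose A = A"
  by (simp add: spd_matrices_def)

lemma spd_pos: "A \<in> spd_matrices \<Longrightarrow> v \<noteq> 0 \<Longrightarrow> 0 < v \<bullet> (A *v v)"
  by (simp add: spd_matrices_def)

lemma spd_nonneg: "A \<in> spd_matrices \<Longrightarrow> 0 \<le> v \<bullet> (A *v v)"
  by (cases "v = 0") (auto dest: spd_pos[of A v])

lemma spd_inner_commute:
  assumes "A \<in> spd_matrices"
  shows "u \<bullet> (A *v v) = v \<bullet> (A *v u)"
  using dot_lmul_matrix[of u A v] transpose_matrix_vector[of A u] spd_symmetric[OF assms]
  by (simp add: inner_commute)

lemma det_nonzero_if_definite:
  fixes A :: "real^'p^'p"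
  assumes "\<And>v. v \<noteq> 0 \<Longrightarrow> 0 < v \<bullet> (A *v v)"
  shows "det A \<noteq> 0"
proof -
  have "\<forall>v. A *v v = 0 \<longrightarrow> v = 0"
    using assms by (metis inner_zero_right less_irrefl)
  then show ?thesis
    using matrix_left_invertible_ker invertible_left_inverse invertible_det_nz by blast
qed

lemma spd_det_nonzero: "A \<in> spd_matrices \<Longrightarrow> det A \<noteq> 0"
  by (rule det_nonzero_if_definite) (rule spd_pos)

text \<open>The segment from \<open>A\<close> to the identity stays inside the definite matrices, so
  the determinant never vanishes along it. By the intermediate value theorem it keeps the sign it
  has at the identity.\<close>

lemma spd_det_pos:
  fixes A :: "real^'p^'p"
  assumes "A \<in> spd_matrices"
  shows "0 < det A"
proof (rule ccontr)
  assume "\<not> 0 < det A"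
  define B where "B t = (\<chi> i j. t * (mat 1 :: real^'p^'p) $ i $ j + (1 - t) * A $ i $ j)" for t :: real
  have cont: "continuous_on {0..1} (\<lambda>t. det (B t))"
    unfolding det_def B_def by (auto intro!: continuous_intros)
  have "B 0 = A" "B 1 = mat 1"
    by (simp_all add: B_def vec_eq_iff)
  then have "det (B 0) \<le> 0" "0 \<le> det (B 1)"
    using \<open>\<not> 0 < det A\<close> by simp_all
  then obtain t where t: "0 \<le> t" "t \<le> 1" "det (B t) = 0"
    using IVT'[of "\<lambda>t. det (B t)" 0 0 1] cont by auto
  have "0 < v \<bullet> (B t *v v)" if "v \<noteq> 0" for v
  proof -
    have "B t = t *\<^sub>R mat 1 + (1 - t) *\<^sub>R A"
      by (simp add: B_def vec_eq_iff)
    then have "v \<bullet> (B t *v v) = t * (v \<bullet> v) + (1 - t) * (v \<bullet> (A *v v))"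
      by (simp add: matrix_vector_mult_add_rdistrib scaleR_matrix_vector_assoc[symmetric] inner_add_right)
    moreover have "0 < v \<bullet> v" "0 < v \<bullet> (A *v v)"
      using that spd_pos[OF assms] by auto
    moreover have "0 < t \<or> 0 < 1 - t" by linarith
    ultimately show ?thesis
      using t by (auto intro: add_pos_nonneg add_nonneg_pos mult_pos_pos)
  qed
  then show False
    using det_nonzero_if_definite t(3) by blast
qed

lemma matrix_inv_mult:
  fixes A :: "real^'p^'p"
  assumes "det A \<noteq> 0"
  shows "A ** matrix_inv A = mat 1" "matrix_inv A ** A = mat 1"
proof -
  have "\<exists>B. A ** B = mat 1 \<and> B ** A = mat 1"
    using assms invertible_det_nz[of A] by (simp add: invertible_def)
  then have "A ** matrix_inv A = mat 1 \<and> matrix_inv A ** A = mat 1"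
    unfolding matrix_inv_def by (rule someI_ex)
  then show "A ** matrix_inv A = mat 1" "matrix_inv A ** A = mat 1" by simp_all
qed

lemma matrix_inv_mult_vec:
  fixes A :: "real^'p^'p"
  assumes "det A \<noteq> 0"
  shows "A *v (matrix_inv A *v v) = v" "matrix_inv A *v (A *v v) = v"
  using matrix_inv_mult[OF assms] by (simp_all add: matrix_vector_mul_assoc)

lemma matrix_inv_spd:
  fixes A :: "real^'p^'p"
  assumes A: "A \<in> spd_matrices"
  shows "matrix_inv A \<in> spd_matrices"
proof -
  note inv = matrix_inv_mult_vec[OF spd_det_nonzero[OF A]]
  have sym: "u \<bullet> (matrix_inv A *v v) = v \<bullet> (matrix_inv A *v u)" for u v
    using spd_inner_commute[OF A, of "matrix_inv A *v u" "matrix_inv A *v v"]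
    by (simp add: inv inner_commute)
  have "matrix_inv A $ i $ j = matrix_inv A $ j $ i" for i j
    using sym[of "axis i 1" "axis j 1"]
    by (simp add: inner_axis' matrix_vector_mult_basis column_def)
  then have "transpose (matrix_inv A) = matrix_inv A"
    by (simp add: transpose_def vec_eq_iff)
  moreover have "0 < v \<bullet> (matrix_inv A *v v)" if "v \<noteq> 0" for v
  proof -
    have "matrix_inv A *v v \<noteq> 0"
      using that inv(1)[of v] by force
    from spd_pos[OF A this] show ?thesis
      by (simp add: inv inner_commute)
  qed
  ultimately show ?thesis by (simp add: spd_matrices_def)
qed

lemma spd_Cauchy_Schwarz:
  assumes A: "A \<in> spd_matrices"
  shows "(u \<bullet> (A *v v))\<^sup>2 \<le> (u \<bullet> (A *v u)) * (v \<bullet> (A *v v))"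
proof (cases "v = 0")
  case False
  define q where "q = v \<bullet> (A *v v)"
  \<comment> \<open>Up to the factor \<open>q\<close>, this is the part of \<open>u\<close> that is
    orthogonal to \<open>v\<close> in the form \<open>A\<close>; nonnegativity of the form at
    \<open>w\<close> is the inequality.\<close>
  define w where "w = q *\<^sub>R u - (u \<bullet> (A *v v)) *\<^sub>R v"
  have q: "0 < q" using spd_pos[OF A False] by (simp add: q_def)
  have "w \<bullet> (A *v w) = q * (q * (u \<bullet> (A *v u)) - (u \<bullet> (A *v v))\<^sup>2)"
    using spd_inner_commute[OF A, of v u]
    by (simp add: w_def q_def algebra_simps inner_diff_left inner_diff_right power2_eq_square
        matrix_vector_mult_diff_distrib matrix_vector_mult_scaleR)
  then have "0 \<le> q * (q * (u \<bullet> (A *v u)) - (u \<bullet> (A *v v))\<^sup>2)"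
    using spd_nonneg[OF A, of w] by simp
  then show ?thesis
    using q by (simp add: zero_le_mult_iff q_def algebra_simps)
qed simp

section \<open>Trace bounds for entries, quadratic form and determinant\<close>

lemma spd_diag_pos:
  assumes "A \<in> spd_matrices"
  shows "0 < A $ i $ i"
  using spd_pos[OF assms, of "axis i 1"]
  by (simp add: inner_axis' matrix_vector_mult_basis column_def axis_eq_0_iff)

lemma spd_entry_le:
  assumes A: "A \<in> spd_matrices"
  shows "\<bar>A $ i $ j\<bar> \<le> sqrt (A $ i $ i) * sqrt (A $ j $ j)"
  using spd_Cauchy_Schwarz[OF A, of "axis i 1" "axis j 1"]
  by (simp add: inner_axis' matrix_vector_mult_basis column_def real_le_rsqrt flip: real_sqrt_mult real_sqrt_abs)

lemma trace_ge_diag: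
  assumes "A \<in> spd_matrices"
  shows "A $ i $ i \<le> trace A"
  unfolding trace_def
  by (rule member_le_sum) (use spd_diag_pos[OF assms] in \<open>auto intro: less_imp_le\<close>)

lemma spd_trace_pos:
  assumes "A \<in> spd_matrices"
  shows "0 < trace A"
  using trace_ge_diag[OF assms] spd_diag_pos[OF assms] less_le_trans by blast

lemma spd_entry_le_trace:
  assumes A: "A \<in> spd_matrices"
  shows "\<bar>A $ i $ j\<bar> \<le> trace A"
proof -
  have "sqrt (A $ i $ i) * sqrt (A $ j $ j) \<le> sqrt (trace A) * sqrt (trace A)"
    by (intro mult_mono) (auto simp: trace_ge_diag[OF A] spd_trace_pos[OF A] less_imp_le spd_diag_pos[OF A])
  then show ?thesis
    using spd_entry_le[OF A, of i j] spd_trace_pos[OF A] by simp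
qed

text \<open>No eigenvalues are needed: each entry is bounded by the geometric mean of two diagonal
  entries, which majorises the form by a perfect square, and Cauchy-Schwarz for sums bounds that
  square.\<close>

lemma spd_quadratic_le_trace:
  fixes A :: "real^'p^'p"
  assumes A: "A \<in> spd_matrices"
  shows "v \<bullet> (A *v v) \<le> trace A * (v \<bullet> v)"
proof -
  have "v \<bullet> (A *v v) = (\<Sum>i\<in>UNIV. \<Sum>j\<in>UNIV. v $ i * (A $ i $ j * v $ j))"
    by (simp add: inner_vec_def matrix_vector_mult_def sum_distrib_left)
  also have "\<dots> \<le> (\<Sum>i\<in>UNIV. \<Sum>j\<in>UNIV. (\<bar>v $ i\<bar> * sqrt (A $ i $ i)) * (\<bar>v $ j\<bar> * sqrt (A $ j $ j)))"
  proof (intro sum_mono)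
    fix i j
    have "v $ i * (A $ i $ j * v $ j) \<le> \<bar>v $ i\<bar> * \<bar>v $ j\<bar> * \<bar>A $ i $ j\<bar>"
      by (simp flip: abs_mult add: mult_ac) 
    also have "\<dots> \<le> \<bar>v $ i\<bar> * \<bar>v $ j\<bar> * (sqrt (A $ i $ i) * sqrt (A $ j $ j))"
      by (intro mult_left_mono spd_entry_le[OF A]) simp
    finally show "v $ i * (A $ i $ j * v $ j) \<le> (\<bar>v $ i\<bar> * sqrt (A $ i $ i)) * (\<bar>v $ j\<bar> * sqrt (A $ j $ j))"
      by (simp add: mult_ac)
  qed
  also have "\<dots> = (\<Sum>i\<in>UNIV. \<bar>v $ i\<bar> * sqrt (A $ i $ i))\<^sup>2"
    by (simp add: sum_product power2_eq_square)
  also have "\<dots> \<le> (\<Sum>i\<in>UNIV. \<bar>v $ i\<bar>\<^sup>2) * (\<Sum>i\<in>UNIV. (sqrt (A $ i $ i))\<^sup>2)"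
    by (rule Cauchy_Schwarz_ineq_sum)
  also have "\<dots> = trace A * (v \<bullet> v)"
    using spd_diag_pos[OF A] by (simp add: trace_def inner_vec_def power2_eq_square less_imp_le)
  finally show ?thesis .
qed

text \<open>A crude bound from the Leibniz expansion. Only polynomial growth in the trace matters,
  since it will be weighed against exponential decay in the trace.\<close>

lemma spd_det_le:
  fixes A :: "real^'p^'p"
  assumes A: "A \<in> spd_matrices"
  shows "det A \<le> fact CARD('p) * trace A ^ CARD('p)"
proof -
  have "det A \<le> (\<Sum>p\<in>{p. p permutes (UNIV :: 'p set)}. trace A ^ CARD('p))"
    unfolding det_def
  proof (rule sum_mono)
    fix p :: "'p \<Rightarrow> 'p"
    have "of_int (sign p) * (\<Prod>i\<in>UNIV. A $ i $ p i) \<le> \<bar>of_int (sign p) * (\<Prod>i\<in>UNIV. A $ i $ p i)\<bar>"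
      by simp
    also have "\<dots> = (\<Prod>i\<in>UNIV. \<bar>A $ i $ p i\<bar>)"
      by (simp add: abs_mult abs_prod sign_def)
    also have "\<dots> \<le> (\<Prod>i\<in>(UNIV::'p set). trace A)"
      by (intro prod_mono) (simp add: spd_entry_le_trace[OF A])
    finally show "of_int (sign p) * (\<Prod>i\<in>UNIV. A $ i $ p i) \<le> trace A ^ CARD('p)" by simp
  qed
  also have "\<dots> = fact CARD('p) * trace A ^ CARD('p)"
    by (simp add: card_permutations)
  finally show ?thesis .
qed

section \<open>Continuity of determinant and inverse\<close>

lemma matrix_inv_mult_vec_cramer:
  fixes A :: "real^'p^'p"
  assumes "det A \<noteq> 0"
  shows "matrix_inv A *v v = (\<chi> k. det (\<chi> i j. if j = k then v $ i else A $ i $ j) / det A)"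
  using cramer[OF assms, of "matrix_inv A *v v" v] matrix_inv_mult_vec[OF assms] by simp

lemma tendsto_det:
  fixes A :: "'a \<Rightarrow> real^'p^'p"
  assumes "(A \<longlongrightarrow> A0) F"
  shows "((\<lambda>x. det (A x)) \<longlongrightarrow> det A0) F"
  unfolding det_def by (intro tendsto_intros assms)

text \<open>Cramer's rule writes each coordinate as a quotient of determinants. It applies wherever
  the determinant is nonzero, which holds eventually along the filter.\<close>

lemma tendsto_matrix_inv_mult_vec:
  fixes A :: "'a \<Rightarrow> real^'p^'p"
  assumes A: "(A \<longlongrightarrow> A0) F" and v: "(v \<longlongrightarrow> v0) F" and det: "det A0 \<noteq> 0"
  shows "((\<lambda>x. matrix_inv (A x) *v v x) \<longlongrightarrow> matrix_inv A0 *v v0) F"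
proof -
  have m: "((\<lambda>x. \<chi> i j. if j = k then v x $ i else A x $ i $ j) \<longlongrightarrow>
          (\<chi> i j. if j = k then v0 $ i else A0 $ i $ j)) F" for k
  proof (intro vec_tendstoI)
    fix i j
    show "((\<lambda>x. (\<chi> i j. if j = k then v x $ i else A x $ i $ j) $ i $ j) \<longlongrightarrow>
          (\<chi> i j. if j = k then v0 $ i else A0 $ i $ j) $ i $ j) F"
      by (cases "j = k") (auto intro!: tendsto_vec_nth A v)
  qed
  have "((\<lambda>x. \<chi> k. det (\<chi> i j. if j = k then v x $ i else A x $ i $ j) / det (A x)) \<longlongrightarrow>
      (\<chi> k. det (\<chi> i j. if j = k then v0 $ i else A0 $ i $ j) / det A0)) F"
    by (rule tendsto_vec_lambda) (rule tendsto_divide[OF tendsto_det[OF m] tendsto_det[OF A] det])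
  moreover have "\<forall>\<^sub>F x in F. det (A x) \<noteq> 0"
    using tendsto_imp_eventually_ne[OF tendsto_det[OF A] det] .
  then have "\<forall>\<^sub>F x in F. (\<chi> k. det (\<chi> i j. if j = k then v x $ i else A x $ i $ j) / det (A x))
      = matrix_inv (A x) *v v x"
    by eventually_elim (simp add: matrix_inv_mult_vec_cramer)
  ultimately show ?thesis
    using det by (simp add: tendsto_cong matrix_inv_mult_vec_cramer)
qed

section \<open>Projections onto cones and the likelihood ratio statistic\<close>

lemma inner_wrt_commute: "S \<in> spd_matrices \<Longrightarrow> inner_wrt S u v = inner_wrt S v u"
  unfolding inner_wrt_def by (rule spd_inner_commute[OF matrix_inv_spd])

lemma inner_wrt_nonneg: "S \<in> spd_matrices \<Longrightarrow> 0 \<le> inner_wrt S v v"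
  unfolding inner_wrt_def by (rule spd_nonneg[OF matrix_inv_spd])

lemma inner_wrt_eq_0_iff: "S \<in> spd_matrices \<Longrightarrow> inner_wrt S v v = 0 \<longleftrightarrow> v = 0"
  unfolding inner_wrt_def using spd_pos[OF matrix_inv_spd, of S v] by fastforce

lemma norm_wrt_power2: "S \<in> spd_matrices \<Longrightarrow> (norm_wrt S v)\<^sup>2 = inner_wrt S v v"
  by (simp add: norm_wrt_def inner_wrt_nonneg)

lemma norm_wrt_le_iff:
  "S \<in> spd_matrices \<Longrightarrow> norm_wrt S u \<le> norm_wrt S v \<longleftrightarrow> inner_wrt S u u \<le> inner_wrt S v v"
  by (simp add: norm_wrt_def)

lemma inner_wrt_linear:
  "inner_wrt S (u + w) v = inner_wrt S u v + inner_wrt S w v"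
  "inner_wrt S (u - w) v = inner_wrt S u v - inner_wrt S w v"
  "inner_wrt S (t *\<^sub>R u) v = t * inner_wrt S u v"
  "inner_wrt S u (v + w) = inner_wrt S u v + inner_wrt S u w"
  "inner_wrt S u (v - w) = inner_wrt S u v - inner_wrt S u w"
  "inner_wrt S u (t *\<^sub>R v) = t * inner_wrt S u v"
  by (simp_all add: inner_wrt_def inner_add_left inner_diff_left inner_add_right inner_diff_right
      matrix_vector_right_distrib matrix_vector_mult_diff_distrib matrix_vector_mult_scaleR)

lemma continuous_on_inner_wrt:
  "continuous_on T f \<Longrightarrow> continuous_on T g \<Longrightarrow> continuous_on T (\<lambda>x. inner_wrt S (f x) (g x))"
  unfolding inner_wrt_def by (intro continuous_intros matrix_vector_mult_linear_continuous_on[THEN continuous_on_compose2]) auto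

text \<open>Cauchy-Schwarz for \<open>S\<close> applied to \<open>u\<close> and
  \<open>matrix_inv S *v v\<close>. With \<open>u\<close> a basis vector it bounds a coordinate of
  \<open>v\<close> by the \<open>S\<close>-norm of \<open>v\<close>.\<close>

lemma power2_inner_le_inner_wrt:
  assumes S: "S \<in> spd_matrices"
  shows "(u \<bullet> v)\<^sup>2 \<le> (u \<bullet> (S *v u)) * inner_wrt S v v"
  using spd_Cauchy_Schwarz[OF S, of u "matrix_inv S *v v"] 
  by (simp add: inner_wrt_def matrix_inv_mult_vec[OF spd_det_nonzero[OF S]] inner_commute)

lemma power2_norm_le_inner_wrt:
  assumes S: "S \<in> spd_matrices"
  shows "v \<bullet> v \<le> trace S * inner_wrt S v v"
proof (cases "v = 0")
  case False
  have "(v \<bullet> v)\<^sup>2 \<le> (v \<bullet> (S *v v)) * inner_wrt S v v"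
    by (rule power2_inner_le_inner_wrt[OF S])
  also have "\<dots> \<le> (trace S * (v \<bullet> v)) * inner_wrt S v v"
    by (intro mult_right_mono spd_quadratic_le_trace inner_wrt_nonneg S)
  finally have "(v \<bullet> v) * (v \<bullet> v) \<le> (v \<bullet> v) * (trace S * inner_wrt S v v)"
    by (simp add: power2_eq_square mult_ac)
  then show ?thesis using False by simp
qed (simp add: inner_wrt_def)

text \<open>\<open>proj_wrt\<close> is a definite description, so it has these properties only once
  existence and uniqueness are shown. Existence comes from compactness of a sublevel set, uniqueness
  from strict convexity of the squared distance.\<close>

lemma proj_wrt_nearest:
  fixes C :: "(real^'p) set"
  assumes S: "S \<in> spd_matrices" and C: "closed C" "convex C" "0 \<in> C"
  shows "proj_wrt S v C \<in> C"
    and "z \<in> C \<Longrightarrow> inner_wrt S (v - proj_wrt S v C) (v - proj_wrt S v C) \<le> inner_wrt S (v - z) (v - z)"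
proof -
  define q where "q z = inner_wrt S (v - z) (v - z)" for z
  have cont: "continuous_on T q" for T
    unfolding q_def by (intro continuous_on_inner_wrt continuous_intros)
  define T where "T = C \<inter> {z. q z \<le> q 0}"
  have "closed T"
    unfolding T_def using cont by (intro closed_Int C closed_Collect_le continuous_intros) auto
  moreover have "bounded T"
  proof (rule boundedI)
    fix z assume "z \<in> T"
    then have "q z \<le> q 0" by (simp add: T_def)
    then have "trace S * q z \<le> trace S * q 0"
      using spd_trace_pos[OF S] by simp
    moreover have "(norm (v - z))\<^sup>2 \<le> trace S * q z"
      unfolding q_def power2_norm_eq_inner by (rule power2_norm_le_inner_wrt[OF S])
    ultimately have "(norm (v - z))\<^sup>2 \<le> trace S * q 0" by linarith
    then have "norm (v - z) \<le> sqrt (trace S * q 0)" by (rule real_le_rsqrt)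
    then show "norm z \<le> norm v + sqrt (trace S * q 0)"
      using norm_triangle_ineq4[of v "v - z"] by simp
  qed
  ultimately have "compact T" by (simp add: compact_eq_bounded_closed)
  moreover have "0 \<in> T" using C by (simp add: T_def)
  ultimately obtain y where y: "y \<in> T" "\<And>z. z \<in> T \<Longrightarrow> q y \<le> q z"
    using continuous_attains_inf[of T q] cont by blast
  have min: "q y \<le> q z" if "z \<in> C" for z
    using y that by (auto simp: T_def) (meson order_trans linear)
  have uniq: "y' = y" if y': "y' \<in> C" "\<And>z. z \<in> C \<Longrightarrow> q y' \<le> q z" for y'
  proof -
    have "(1 / 2) *\<^sub>R y + (1 / 2) *\<^sub>R y' \<in> C"
      using C(2) y'(1) y(1) by (intro convexD) (auto simp: T_def)
    from min[OF this] have "q y \<le> q ((1 / 2) *\<^sub>R y + (1 / 2) *\<^sub>R y')" .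
    moreover have "q y' \<le> q y" using y' y by (auto simp: T_def)
    \<comment> \<open>Parallelogram law: the midpoint of two distinct minimisers would be strictly
      closer to \<open>v\<close>.\<close>
    moreover have "4 * q ((1 / 2) *\<^sub>R y + (1 / 2) *\<^sub>R y') = 2 * q y + 2 * q y' - inner_wrt S (y - y') (y - y')"
      unfolding q_def inner_wrt_linear
      using inner_wrt_commute[OF S, of y y'] inner_wrt_commute[OF S, of y v] inner_wrt_commute[OF S, of y' v]
      by (simp add: algebra_simps)
    ultimately have "inner_wrt S (y - y') (y - y') \<le> 0" by linarith
    then show ?thesis
      using inner_wrt_nonneg[OF S, of "y - y'"] inner_wrt_eq_0_iff[OF S, of "y - y'"] by simp
  qed
  have "y \<in> C" using y by (simp add: T_def)
  then have "proj_wrt S v C = y"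
    unfolding proj_wrt_def norm_wrt_le_iff[OF S] q_def[symmetric]
    using min uniq by (intro the_equality) blast+
  then show "proj_wrt S v C \<in> C"
    "z \<in> C \<Longrightarrow> inner_wrt S (v - proj_wrt S v C) (v - proj_wrt S v C) \<le> inner_wrt S (v - z) (v - z)"
    using \<open>y \<in> C\<close> min[of z] by (simp_all flip: q_def)
qed

text \<open>A cone contains the whole ray through \<open>y\<close>, and \<open>y\<close> is nearest
  to \<open>v\<close> on that ray. Hence the residual \<open>v - y\<close> is orthogonal to
  \<open>y\<close>.\<close>

lemma proj_wrt_cone_Pythagoras:
  fixes C :: "(real^'p) set" and v :: "real^'p"
  assumes S: "S \<in> spd_matrices" and C: "closed C" "convex C" "cone C" "0 \<in> C"
  defines "y \<equiv> proj_wrt S v C"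
  shows "inner_wrt S v v = inner_wrt S y y + inner_wrt S (v - y) (v - y)"
proof -
  define b where "b = inner_wrt S v y"
  define q where "q = inner_wrt S y y"
  note proj = proj_wrt_nearest[OF S C(1,2,4), where v = v, folded y_def]
  have expand: "inner_wrt S (v - t *\<^sub>R y) (v - t *\<^sub>R y) = inner_wrt S v v - 2 * t * b + t\<^sup>2 * q" for t
    unfolding inner_wrt_linear using inner_wrt_commute[OF S, of v y]
    by (simp add: b_def q_def power2_eq_square algebra_simps)
  have ray: "q - 2 * b \<le> t\<^sup>2 * q - 2 * t * b" if "0 \<le> t" for t
    using proj(2)[of "t *\<^sub>R y"] mem_cone[OF C(3) proj(1) that] expand[of t] expand[of 1] by simp
  have "b = q"
  proof (cases "q = 0")
    case True
    then have "y = 0" using inner_wrt_eq_0_iff[OF S] by (simp add: q_def)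
    then show ?thesis by (simp add: b_def q_def inner_wrt_def)
  next
    case False
    then have q: "0 < q" using inner_wrt_nonneg[OF S, of y] by (simp add: q_def)
    have "0 \<le> b" using ray[of 0] q by simp
    \<comment> \<open>\<open>t = b / q\<close> is the vertex of the quadratic on the ray; comparing
      it with \<open>t = 1\<close> leaves \<open>(b - q)^2 \<le> 0\<close>.\<close>
    then have "q - 2 * b \<le> (b / q)\<^sup>2 * q - 2 * (b / q) * b" using q by (intro ray) simp
    then have "(q - 2 * b) * q \<le> ((b / q)\<^sup>2 * q - 2 * (b / q) * b) * q"
      using q by (intro mult_right_mono) auto
    also have "\<dots> = - b\<^sup>2" using q by (simp add: power2_eq_square field_simps)
    finally have "(b - q)\<^sup>2 \<le> 0" by (simp add: power2_eq_square algebra_simps)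
    then show ?thesis by simp
  qed
  then show ?thesis using expand[of 1] by (simp add: q_def)
qed

text \<open>In this form the cone enters only through the squared distance from \<open>y\<close> to
  it, and the statistic decreases in that distance. Bounds on the distance become bounds on the
  statistic without computing any projection.\<close>

lemma lrt_stat_eq:
  fixes C :: "(real^'p) set" and x :: "real^'p^'n"
  assumes S: "scatter_matrix x \<in> spd_matrices" and C: "closed C" "convex C" "cone C" "0 \<in> C"
  defines "S \<equiv> scatter_matrix x" and "y \<equiv> sqrt (real CARD('n)) *\<^sub>R sample_mean x"
  shows "lrt_stat C x = (1 + inner_wrt S y y) / (1 + inner_wrt S (y - proj_wrt S y C) (y - proj_wrt S y C)) - 1"
proof -
  let ?z = "proj_wrt S y C"
  have "lrt_stat C x = inner_wrt S ?z ?z / (1 + inner_wrt S (y - ?z) (y - ?z))"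
    using S by (simp add: lrt_stat_def Let_def norm_wrt_power2 flip: S_def y_def)
  moreover have "inner_wrt S y y = inner_wrt S ?z ?z + inner_wrt S (y - ?z) (y - ?z)"
    unfolding S_def by (rule proj_wrt_cone_Pythagoras[OF S C])
  moreover have "0 \<le> inner_wrt S (y - ?z) (y - ?z)"
    using S by (simp add: inner_wrt_nonneg S_def)
  ultimately show ?thesis by (simp add: field_simps)
qed

text \<open>A cone inside the half-space is at least as far from \<open>y\<close> as the half-space
  is, and the squared \<open>S\<close>-distance to the latter is
  \<open>(min 0 (y $ k))\<^sup>2 / S $ k $ k\<close>.\<close>

lemma lrt_stat_le:
  fixes C :: "(real^'p) set" and x :: "real^'p^'n"
  assumes S: "scatter_matrix x \<in> spd_matrices" and C: "closed C" "convex C" "cone C" "0 \<in> C"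
    and half: "C \<subseteq> half_space k"
  defines "S \<equiv> scatter_matrix x" and "y \<equiv> sqrt (real CARD('n)) *\<^sub>R sample_mean x"
  shows "lrt_stat C x \<le> (1 + inner_wrt S y y) / (1 + (min 0 (y $ k))\<^sup>2 / S $ k $ k) - 1"
proof -
  let ?z = "proj_wrt S y C"
  have Skk: "0 < S $ k $ k" using S spd_diag_pos by (simp add: S_def)
  have "?z $ k \<ge> 0" using proj_wrt_nearest(1)[OF S C(1,2,4), where v = y] half by (auto simp: half_space_def S_def)
  then have "(min 0 (y $ k))\<^sup>2 \<le> ((y - ?z) $ k)\<^sup>2"
    by (cases "y $ k \<le> 0") (auto simp: min_def abs_le_square_iff[symmetric])
  also have "\<dots> \<le> S $ k $ k * inner_wrt S (y - ?z) (y - ?z)"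
    using power2_inner_le_inner_wrt[OF S, of "axis k 1" "y - ?z"]
    by (simp add: inner_axis' matrix_vector_mult_basis column_def S_def)
  finally have "(min 0 (y $ k))\<^sup>2 / S $ k $ k \<le> inner_wrt S (y - ?z) (y - ?z)"
    using Skk by (simp add: field_simps)
  moreover have "0 \<le> (min 0 (y $ k))\<^sup>2 / S $ k $ k" "0 \<le> inner_wrt S y y"
    using Skk S by (simp_all add: inner_wrt_nonneg S_def)
  ultimately show ?thesis
    unfolding lrt_stat_eq[OF S C, folded S_def y_def] by (intro diff_right_mono divide_left_mono) (auto intro!: mult_pos_pos)
qed

lemma lrt_stat_ge:
  fixes C :: "(real^'p) set" and x :: "real^'p^'n"
  assumes S: "scatter_matrix x \<in> spd_matrices" and C: "closed C" "convex C" "cone C" "0 \<in> C"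
    and z: "z \<in> C"
  defines "S \<equiv> scatter_matrix x" and "y \<equiv> sqrt (real CARD('n)) *\<^sub>R sample_mean x"
  shows "(1 + inner_wrt S y y) / (1 + inner_wrt S (y - z) (y - z)) - 1 \<le> lrt_stat C x"
proof -
  have nn: "0 \<le> inner_wrt S v v" for v using S by (simp add: inner_wrt_nonneg S_def)
  show ?thesis
    unfolding lrt_stat_eq[OF S C, folded S_def y_def]
    using proj_wrt_nearest(2)[OF S C(1,2,4) z, folded S_def, where v = y] nn
    by (intro diff_right_mono divide_left_mono) (auto intro!: mult_pos_pos add_pos_nonneg)
qed

section \<open>The scatter matrix as a function of the sample\<close>

lemma scatter_matrix_nth:
  fixes x :: "real^'p^'n"
  defines "y \<equiv> sqrt (real CARD('n)) *\<^sub>R sample_mean x"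
  shows "scatter_matrix x $ a $ b = (\<Sum>i\<in>UNIV. x $ i $ a * x $ i $ b) - y $ a * y $ b"
proof -
  define m where "m = sample_mean x"
  have m: "(\<Sum>i\<in>UNIV. x $ i $ a) = real CARD('n) * m $ a" for a
    by (simp add: m_def sample_mean_def)
  have "scatter_matrix x $ a $ b = (\<Sum>i\<in>UNIV. (x $ i $ a - m $ a) * (x $ i $ b - m $ b))"
    by (simp add: scatter_matrix_def m_def)
  also have "\<dots> = (\<Sum>i\<in>UNIV. x $ i $ a * x $ i $ b - m $ a * x $ i $ b - m $ b * x $ i $ a + m $ a * m $ b)"
    by (simp add: algebra_simps)
  also have "\<dots> = (\<Sum>i\<in>UNIV. x $ i $ a * x $ i $ b) - m $ a * (\<Sum>i\<in>UNIV. x $ i $ b)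
      - m $ b * (\<Sum>i\<in>UNIV. x $ i $ a) + real CARD('n) * (m $ a * m $ b)"
    by (simp add: sum.distrib sum_subtractf sum_distrib_left)
  also have "\<dots> = (\<Sum>i\<in>UNIV. x $ i $ a * x $ i $ b) - y $ a * y $ b"
    unfolding m by (simp add: y_def flip: m_def)
  finally show ?thesis .
qed

text \<open>The scatter matrix is a sum of matrices \<open>d d'\<close>. A vector on which its form
  vanishes is orthogonal to every \<open>d i\<close>, hence lies in the kernel, so nonsingularity
  already forces definiteness.\<close>

lemma scatter_matrix_spd:
  fixes x :: "real^'p^'n"
  assumes "det (scatter_matrix x) \<noteq> 0"
  shows "scatter_matrix x \<in> spd_matrices"
proof -
  define d where "d i = x $ i - sample_mean x" for i
  have S: "scatter_matrix x *v v = (\<Sum>i\<in>UNIV. (d i \<bullet> v) *\<^sub>R d i)" for v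
  proof -
    have "(scatter_matrix x *v v) $ a = (\<Sum>b\<in>UNIV. \<Sum>i\<in>UNIV. d i $ a * d i $ b * v $ b)" for a
      by (simp add: scatter_matrix_def matrix_vector_mult_def d_def sum_distrib_right)
    also have "\<dots> a = (\<Sum>i\<in>UNIV. \<Sum>b\<in>UNIV. d i $ a * d i $ b * v $ b)" for a
      by (rule sum.swap)
    also have "\<dots> a = (\<Sum>i\<in>UNIV. (d i \<bullet> v) *\<^sub>R d i) $ a" for a
      by (simp add: inner_vec_def sum_distrib_left mult_ac)
    finally show ?thesis by (simp add: vec_eq_iff)
  qed
  have quad: "v \<bullet> (scatter_matrix x *v v) = (\<Sum>i\<in>UNIV. (d i \<bullet> v)\<^sup>2)" for v
    by (simp add: S inner_sum_right power2_eq_square inner_commute)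
  have "0 < v \<bullet> (scatter_matrix x *v v)" if "v \<noteq> 0" for v
  proof (rule ccontr)
    assume "\<not> ?thesis"
    then have "(\<Sum>i\<in>UNIV. (d i \<bullet> v)\<^sup>2) = 0"
      using sum_nonneg[of UNIV "\<lambda>i. (d i \<bullet> v)\<^sup>2"] by (simp add: quad)
    then have "scatter_matrix x *v v = 0" by (simp add: S sum_nonneg_eq_0_iff)
    then show False
      using matrix_inv_mult_vec(2)[OF assms, of v] that by simp
  qed
  moreover have "transpose (scatter_matrix x) = scatter_matrix x"
    by (simp add: scatter_matrix_def transpose_def vec_eq_iff mult.commute)
  ultimately show ?thesis by (simp add: spd_matrices_def)
qed

lemma tendsto_sample_mean:
  "(f \<longlongrightarrow> x) F \<Longrightarrow> ((\<lambda>t. sample_mean (f t)) \<longlongrightarrow> sample_mean x) F"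
  unfolding sample_mean_def by (intro tendsto_intros)

lemma tendsto_scatter_matrix:
  assumes "(f \<longlongrightarrow> x) F"
  shows "((\<lambda>t. scatter_matrix (f t)) \<longlongrightarrow> scatter_matrix x) F"
  unfolding scatter_matrix_def
  by (intro tendsto_sum tendsto_vec_lambda tendsto_mult tendsto_vec_nth tendsto_diff tendsto_sample_mean assms)

lemma tendsto_inner_wrt:
  assumes "(S \<longlongrightarrow> S0) F" "(u \<longlongrightarrow> u0) F" "(v \<longlongrightarrow> v0) F" "det S0 \<noteq> 0"
  shows "((\<lambda>t. inner_wrt (S t) (u t) (v t)) \<longlongrightarrow> inner_wrt S0 u0 v0) F"
  unfolding inner_wrt_def by (intro tendsto_inner tendsto_matrix_inv_mult_vec assms)

section \<open>Rigidity of Laplace transforms\<close>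

text \<open>The weights 1, -3, 3, -1 at \<open>- x\<close>, 0, \<open>x\<close>,
  \<open>2 * x\<close> annihilate quadratic polynomials. The cubic Taylor remainders add up to
  \<open>(1 + 3 + 8) / 6 = 2\<close> times \<open>B * x ^ 3\<close>.\<close>

lemma third_difference_bound:
  fixes g g1 g2 g3 :: "real \<Rightarrow> real"
  assumes d: "\<And>t. (g has_real_derivative g1 t) (at t)" "\<And>t. (g1 has_real_derivative g2 t) (at t)"
      "\<And>t. (g2 has_real_derivative g3 t) (at t)"
    and bound: "\<And>t. \<bar>t\<bar> \<le> 2 * x \<Longrightarrow> \<bar>g3 t\<bar> \<le> B"
    and x: "0 \<le> x"
  shows "\<bar>g (- x) - 3 * g 0 + 3 * g x - g (2 * x)\<bar> \<le> 2 * B * x ^ 3"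
proof -
  define diff where "diff m = (if m = 0 then g else if m = 1 then g1 else if m = 2 then g2 else g3)" for m :: nat
  have taylor: "\<bar>g y - (g 0 + g1 0 * y + g2 0 / 2 * y\<^sup>2)\<bar> \<le> B / 6 * \<bar>y\<bar> ^ 3" if y: "\<bar>y\<bar> \<le> 2 * x" for y
  proof -
    have "\<forall>m t. m < 3 \<and> \<bar>t\<bar> \<le> \<bar>y\<bar> \<longrightarrow> DERIV (diff m) t :> diff (Suc m) t"
    proof (intro allI impI)
      fix m :: nat and t :: real assume "m < 3 \<and> \<bar>t\<bar> \<le> \<bar>y\<bar>"
      then have "m = 0 \<or> m = 1 \<or> m = 2" by linarith
      then show "DERIV (diff m) t :> diff (Suc m) t"
        by (auto simp: diff_def d)
    qed
    from Maclaurin_bi_le[of diff g 3 y, OF _ this]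
    obtain t where t: "\<bar>t\<bar> \<le> \<bar>y\<bar>"
      "g y = (\<Sum>m<3. diff m 0 / (fact m) * y ^ m) + diff 3 t / (fact 3) * y ^ 3"
      by (auto simp: diff_def)
    have "g y - (g 0 + g1 0 * y + g2 0 / 2 * y\<^sup>2) = g3 t / 6 * y ^ 3"
      using t(2) by (simp add: diff_def eval_nat_numeral)
    moreover have "\<bar>g3 t / 6 * y ^ 3\<bar> \<le> B / 6 * \<bar>y\<bar> ^ 3"
      using bound[of t] t(1) y by (simp add: abs_mult power_abs mult_right_mono)
    ultimately show ?thesis by (simp only:)
  qed
  have "\<bar>g (- x) - (g 0 + g1 0 * (- x) + g2 0 / 2 * x\<^sup>2)\<bar> \<le> B / 6 * x ^ 3"
    "\<bar>g x - (g 0 + g1 0 * x + g2 0 / 2 * x\<^sup>2)\<bar> \<le> B / 6 * x ^ 3"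
    "\<bar>g (2 * x) - (g 0 + g1 0 * (2 * x) + g2 0 / 2 * (4 * x\<^sup>2))\<bar> \<le> B / 6 * (8 * x ^ 3)"
    using taylor[of "- x"] taylor[of x] taylor[of "2 * x"] x by (simp_all add: power_mult_distrib)
  then show ?thesis unfolding abs_le_iff by (simp add: algebra_simps)
qed

text \<open>A single term of the exponential series is at most the sum. This absorbs polynomial
  factors into an exponential of arbitrarily small rate.\<close>

lemma power_le_exp:
  fixes x e :: real
  assumes "0 \<le> x" "0 < e"
  shows "x ^ m \<le> fact m / e ^ m * exp (e * x)"
proof -
  have "(e * x) ^ m / fact m \<le> exp (e * x)"
  proof -
    have "(\<Sum>n\<in>{m}. (e * x) ^ n /\<^sub>R fact n) \<le> (\<Sum>n. (e * x) ^ n /\<^sub>R fact n)"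
      using assms by (intro sum_le_suminf sums_summable[OF exp_converges]) auto
    then show ?thesis
      by (simp add: exp_def divide_inverse mult.commute)
  qed
  then show ?thesis
    using assms by (simp add: field_simps power_mult_distrib)
qed

text \<open>The right side is the convexity gap of \<open>exp (a * u + b * v)\<close> in
  \<open>u\<close> on the chord from 0 to \<open>u2\<close>, taken at \<open>u1\<close>. Apart from
  the factor \<open>u2 - u1\<close> the lower bound depends on neither the chord nor
  \<open>v\<close>, and it vanishes only for \<open>a = 0\<close>.\<close>

lemma exp_chord_lower:
  fixes a b u1 u2 v r :: real
  assumes u: "0 < u1" "u1 < u2" "u2 \<le> 1" and r: "0 < r" "r / 2 \<le> u1" and v: "\<bar>v\<bar> \<le> 1"
  shows "(u2 - u1) * (exp (- \<bar>b\<bar>) * (1 - exp (- (\<bar>a\<bar> * r / 4)))\<^sup>2)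
     \<le> u1 * exp (a * u2 + b * v) + (u2 - u1) * exp (b * v) - u2 * exp (a * u1 + b * v)"
proof -
  define x where "x = a * u1"
  have A: "(1 - exp (- (\<bar>a\<bar> * r / 4)))\<^sup>2 \<le> (exp (x / 2) - 1)\<^sup>2"
  proof -
    \<comment> \<open>The assumption \<open>r / 2 \<le> u1\<close> removes \<open>u1\<close> from
      the bound.\<close>
    have le: "\<bar>a\<bar> * r / 4 \<le> \<bar>x\<bar> / 2"
      using mult_left_mono[OF r(2), of "\<bar>a\<bar>"] u by (simp add: x_def abs_mult mult_ac)
    then have "exp (- (\<bar>x\<bar> / 2)) \<le> exp (- (\<bar>a\<bar> * r / 4))" by simp
    moreover have "1 - exp (- (\<bar>x\<bar> / 2)) \<le> \<bar>exp (x / 2) - 1\<bar>"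
    proof (cases "0 \<le> x")
      case True
      have "1 \<le> exp (x / 2)" using True by simp
      moreover have "2 \<le> exp (x / 2) + exp (- (x / 2))"
        using exp_ge_add_one_self[of "x / 2"] exp_ge_add_one_self[of "- (x / 2)"] by linarith
      ultimately show ?thesis using True by (simp add: abs_if)
    qed (simp add: abs_if)
    moreover have "0 \<le> 1 - exp (- (\<bar>a\<bar> * r / 4))" using r by simp
    ultimately have "\<bar>1 - exp (- (\<bar>a\<bar> * r / 4))\<bar> \<le> \<bar>exp (x / 2) - 1\<bar>" 
      using le by (smt (verit, best) exp_le_cancel_iff)
    then show ?thesis by (simp add: abs_le_square_iff)
  qed
  have B: "(exp (x / 2) - 1)\<^sup>2 \<le> 1 - exp x + x * exp x"
  proof -
    have "(1 - x / 2) \<le> exp (- (x / 2))" using exp_ge_add_one_self[of "- (x / 2)"] by simp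
    then have "(1 - x / 2) * exp x \<le> exp (- (x / 2)) * exp x"
      by (intro mult_right_mono) simp_all
    also have "\<dots> = exp (x / 2)" by (simp flip: exp_add)
    finally have "(1 - x / 2) * exp x \<le> exp (x / 2)" .
    moreover have "exp (x / 2) * exp (x / 2) = exp x" by (simp flip: exp_add)
    ultimately show ?thesis by (simp add: power2_eq_square algebra_simps)
  qed
  \<comment> \<open>The tangent at \<open>u1\<close> lies below the exponential at
    \<open>u2\<close>; the gap is then \<open>u2 - u1\<close> times the tangent defect of the
    exponential at 0, which \<open>B\<close> bounds below.\<close>
  have "exp (a * u1) * (1 + a * (u2 - u1)) \<le> exp (a * u1) * exp (a * (u2 - u1))"
    by (intro mult_left_mono exp_ge_add_one_self) simp
  also have "\<dots> = exp (a * u2)" by (simp flip: exp_add add: algebra_simps)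
  finally have "u1 * (exp x * (1 + a * (u2 - u1))) \<le> u1 * exp (a * u2)"
    using u by (simp add: x_def)
  then have C: "(u2 - u1) * (1 - exp x + x * exp x) \<le> u1 * exp (a * u2) + (u2 - u1) - u2 * exp x"
    by (simp add: x_def algebra_simps)
  have "\<bar>b * v\<bar> \<le> \<bar>b\<bar>" using mult_left_mono[OF v, of "\<bar>b\<bar>"] by (simp add: abs_mult)
  then have "exp (- \<bar>b\<bar>) \<le> exp (b * v)" by simp
  then have "exp (- \<bar>b\<bar>) * ((u2 - u1) * (1 - exp (- (\<bar>a\<bar> * r / 4)))\<^sup>2)
     \<le> exp (b * v) * ((u2 - u1) * (1 - exp x + x * exp x))"
    using u order_trans[OF A B] by (intro mult_mono mult_nonneg_nonneg mult_left_mono) auto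
  also have "\<dots> \<le> exp (b * v) * (u1 * exp (a * u2) + (u2 - u1) - u2 * exp x)"
    by (intro mult_left_mono C) simp
  finally show ?thesis by (simp add: x_def exp_add algebra_simps)
qed

lemma abs_cos_minus_one_le: "\<bar>cos t - 1\<bar> \<le> \<bar>t\<bar>" for t :: real
proof -
  have "\<bar>cos t - 1\<bar> = 2 * (\<bar>sin (t / 2)\<bar> * \<bar>sin (t / 2)\<bar>)"
    using cos_double_sin[of "t / 2"] by (simp add: power2_eq_square)
  also have "\<dots> \<le> 2 * (\<bar>t / 2\<bar> * 1)"
    by (intro mult_left_mono mult_mono abs_sin_x_le_abs_x abs_sin_le_one) simp_all
  finally show ?thesis by simp
qed

text \<open>Third difference along the circle of radius \<open>r\<close>, around the point
  \<open>(r, 0)\<close>. The bound has the form of an exponential in \<open>a\<close>,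
  \<open>\<bar>a\<bar>\<close> and \<open>\<bar>b\<bar>\<close> so that it can later be integrated
  over \<open>a\<close> and \<open>b\<close>.\<close>

lemma exp_circle_third_difference:
  fixes a b r e x :: real
  assumes e: "0 < e" and x: "0 \<le> x" "2 * x \<le> e" and r: "0 < r" "r < 1"
  defines "g \<equiv> \<lambda>t. exp (r * (a * cos t + b * sin t))"
  shows "\<bar>g (- x) - 3 * g 0 + 3 * g x - g (2 * x)\<bar>
    \<le> 2 * ((1 / e + 6 / e\<^sup>2 + 6 / e ^ 3) * exp (a * r + 2 * e * (\<bar>a\<bar> + \<bar>b\<bar>))) * x ^ 3"
proof -
  define s where "s = \<bar>a\<bar> + \<bar>b\<bar>"
  \<comment> \<open>\<open>q1\<close> is the derivative of the exponent, \<open>q2\<close> that of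
    \<open>q1\<close>, and \<open>- q1\<close> that of \<open>q2\<close>. So the derivatives of
    \<open>g\<close> are \<open>g\<close> times polynomials in \<open>q1\<close> and
    \<open>q2\<close>, both bounded by \<open>s\<close>.\<close>
  define q1 where "q1 t = r * (b * cos t - a * sin t)" for t
  define q2 where "q2 t = - (r * (a * cos t + b * sin t))" for t
  have [simp]: "0 \<le> s" by (simp add: s_def)
  have bd: "\<bar>r * (c * cos t + d * sin t)\<bar> \<le> \<bar>c\<bar> + \<bar>d\<bar>" for c d t
  proof -
    have "\<bar>c * cos t + d * sin t\<bar> \<le> \<bar>c\<bar> + \<bar>d\<bar>"
      using mult_left_mono[OF abs_cos_le_one[of t], of "\<bar>c\<bar>"] mult_left_mono[OF abs_sin_le_one[of t], of "\<bar>d\<bar>"]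
        abs_triangle_ineq[of "c * cos t" "d * sin t"]
      unfolding abs_mult by linarith
    then show ?thesis
      using mult_mono[of "\<bar>r\<bar>" 1 "\<bar>c * cos t + d * sin t\<bar>" "\<bar>c\<bar> + \<bar>d\<bar>"] r by (simp add: abs_mult)
  qed
  have q1: "\<bar>q1 t\<bar> \<le> s" and q2: "\<bar>q2 t\<bar> \<le> s" for t
    using bd[of b t "- a"] bd[of "-a" t "- b"] by (simp_all add: q1_def q2_def s_def algebra_simps)
  have dq1: "(q1 has_real_derivative q2 t) (at t)" and dq2: "(q2 has_real_derivative - q1 t) (at t)" for t
    unfolding q1_def q2_def by (auto intro!: derivative_eq_intros simp: algebra_simps)
  have dg: "(g has_real_derivative g t * q1 t) (at t)" for t
    unfolding g_def q1_def by (auto intro!: derivative_eq_intros simp: algebra_simps)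
  have dg1: "((\<lambda>t. g t * q1 t) has_real_derivative g t * (q2 t + (q1 t)\<^sup>2)) (at t)" for t
    by (auto intro!: derivative_eq_intros dg dq1 simp: algebra_simps power2_eq_square)
  have dg2: "((\<lambda>t. g t * (q2 t + (q1 t)\<^sup>2)) has_real_derivative g t * (- q1 t + 3 * (q1 t * q2 t) + q1 t ^ 3)) (at t)" for t
    by (auto intro!: derivative_eq_intros dg dq1 dq2 simp: algebra_simps power2_eq_square power3_eq_cube)
  have bound: "\<bar>g t * (- q1 t + 3 * (q1 t * q2 t) + q1 t ^ 3)\<bar>
      \<le> (1 / e + 6 / e\<^sup>2 + 6 / e ^ 3) * exp (a * r + 2 * e * (\<bar>a\<bar> + \<bar>b\<bar>))" if t: "\<bar>t\<bar> \<le> 2 * x" for t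
  proof -
    have "\<bar>q1 t * q2 t\<bar> \<le> s * s"
      using mult_mono[OF q1 q2] by (simp add: abs_mult)
    moreover have "\<bar>q1 t ^ 3\<bar> \<le> s ^ 3"
      using power_mono[OF q1, of t 3] by (simp add: power_abs)
    ultimately have "\<bar>- q1 t + 3 * (q1 t * q2 t) + q1 t ^ 3\<bar> \<le> s ^ 1 + 3 * s ^ 2 + s ^ 3"
      using q1[of t] by (simp add: power2_eq_square)
    also have "\<dots> \<le> (1 / e + 6 / e\<^sup>2 + 6 / e ^ 3) * exp (e * s)"
      using power_le_exp[of s e 1] power_le_exp[of s e 2] power_le_exp[of s e 3] e
      by (simp add: algebra_simps fact_numeral)
    finally have 1: "\<bar>- q1 t + 3 * (q1 t * q2 t) + q1 t ^ 3\<bar> \<le> (1 / e + 6 / e\<^sup>2 + 6 / e ^ 3) * exp (e * s)" .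
    \<comment> \<open>Moving from angle 0 to \<open>t\<close> changes the exponent by at most
      \<open>e * s\<close>. Another \<open>e * s\<close> is spent on the polynomial factor, which
      explains the rate \<open>2 * e\<close>.\<close>
    have "a * (cos t - 1) + b * sin t \<le> \<bar>a * (cos t - 1)\<bar> + \<bar>b * sin t\<bar>" by linarith
    also have "\<dots> \<le> \<bar>a\<bar> * \<bar>t\<bar> + \<bar>b\<bar> * \<bar>t\<bar>"
      unfolding abs_mult by (intro add_mono mult_left_mono abs_cos_minus_one_le abs_sin_x_le_abs_x) simp_all
    also have "\<dots> = s * \<bar>t\<bar>" by (simp add: s_def algebra_simps)
    also have "\<dots> \<le> s * e" using t x by (intro mult_left_mono) auto
    finally have "a * (cos t - 1) + b * sin t \<le> s * e" .
    then have "r * (a * (cos t - 1) + b * sin t) \<le> r * (s * e)" using r by simp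
    also have "\<dots> \<le> s * e" using r e by (intro mult_left_le_one_le) auto
    finally have "g t \<le> exp (a * r + e * s)"
      by (simp add: g_def algebra_simps)
    with 1 have "g t * \<bar>- q1 t + 3 * (q1 t * q2 t) + q1 t ^ 3\<bar>
       \<le> exp (a * r + e * s) * ((1 / e + 6 / e\<^sup>2 + 6 / e ^ 3) * exp (e * s))"
      by (intro mult_mono) (auto simp: g_def)
    also have "\<dots> = (1 / e + 6 / e\<^sup>2 + 6 / e ^ 3) * exp (a * r + 2 * e * s)"
      by (simp add: exp_add flip: mult.assoc) (simp add: mult.assoc flip: exp_add)
    finally show ?thesis by (simp add: abs_mult s_def g_def)
  qed
  show ?thesis
    by (rule third_difference_bound[OF dg dg1 dg2 bound x(1)])
qed

text \<open>Comparing orders \<open>t\<^sup>2\<close> and \<open>t ^ 3\<close> below the corner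
  \<open>(r, 0)\<close> gives \<open>a = 0\<close>. The transform then depends on \<open>v\<close>
  only, and three points of the circular arc give \<open>b = 0\<close>.\<close>

lemma Laplace_transform_rigidity:
  fixes a b h :: "'a \<Rightarrow> real" and c r :: real
  assumes [measurable]: "a \<in> borel_measurable M" "b \<in> borel_measurable M" "h \<in> borel_measurable M"
    and h: "\<And>x. x \<in> space M \<Longrightarrow> 0 < h x"
    and int: "\<And>u v. u\<^sup>2 + v\<^sup>2 < 1 \<Longrightarrow> integrable M (\<lambda>x. h x * exp (a x * u + b x * v))"
    and r: "0 < r" "r < 1"
    and circle: "\<And>u v. 0 \<le> u \<Longrightarrow> 0 \<le> v \<Longrightarrow> u\<^sup>2 + v\<^sup>2 = r\<^sup>2 \<Longrightarrow>
      (\<integral>x. h x * exp (a x * u + b x * v) \<partial>M) = c"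
    and ellipse: "\<And>u v. 0 \<le> u \<Longrightarrow> v \<le> 0 \<Longrightarrow> u\<^sup>2 \<le> r\<^sup>2 * (1 - v\<^sup>2) \<Longrightarrow> u\<^sup>2 + v\<^sup>2 < 1 \<Longrightarrow>
      (\<integral>x. h x * exp (a x * u + b x * v) \<partial>M) \<le> c"
  shows "AE x in M. a x = 0 \<and> b x = 0"
proof -
  define f where "f u v x = h x * exp (a x * u + b x * v)" for u v x
  define F where "F u v = (\<integral>x. f u v x \<partial>M)" for u v
  have int_f: "integrable M (f u v)" if "u\<^sup>2 + v\<^sup>2 < 1" for u v
    using int[OF that] by (simp add: f_def[abs_def])
  have r2: "r\<^sup>2 < 1" using r by (simp add: power2_eq_square mult_less_cancel_left1 less_trans mult_strict_mono[of r 1 r 1, simplified])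
  have F_circle: "F u v = c" if "0 \<le> u" "0 \<le> v" "u\<^sup>2 + v\<^sup>2 = r\<^sup>2" for u v
    using circle[OF that] by (simp add: F_def f_def)
  have F_ellipse: "F u v \<le> c" if "0 \<le> u" "v \<le> 0" "u\<^sup>2 \<le> r\<^sup>2 * (1 - v\<^sup>2)" "u\<^sup>2 + v\<^sup>2 < 1" for u v
    using ellipse[OF that] by (simp add: F_def f_def)
  have rsc: "(r * cos t)\<^sup>2 + (r * sin t)\<^sup>2 = r\<^sup>2" for t
    by (simp add: power_mult_distrib flip: distrib_left)

  \<comment> \<open>Small enough for the four corners
    \<open>(r \<plusminus> 2 * e, \<plusminus> 2 * e)\<close> to lie in the open unit disk, where
    integrability is assumed.\<close>
  define e where "e = (1 - r) / 8"
  have e: "0 < e" "e \<le> 1 / 8" "(r + 2 * e)\<^sup>2 + (2 * e)\<^sup>2 < 1" "(r - 2 * e)\<^sup>2 + (2 * e)\<^sup>2 < 1"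
  proof -
    show "0 < e" "e \<le> 1 / 8" using r by (simp_all add: e_def)
    have r': "r = 1 - 8 * e" by (simp add: e_def field_simps)
    have "e * e \<le> e * (1 / 8)" using \<open>0 < e\<close> \<open>e \<le> 1 / 8\<close> by (intro mult_left_mono) auto
    then show "(r + 2 * e)\<^sup>2 + (2 * e)\<^sup>2 < 1" "(r - 2 * e)\<^sup>2 + (2 * e)\<^sup>2 < 1"
      using \<open>0 < e\<close> \<open>e \<le> 1 / 8\<close> unfolding r' by (simp_all add: power2_eq_square algebra_simps)
  qed
  \<comment> \<open>Majorant of the third difference of the integrand, without the factor
    \<open>t ^ 3\<close>. For each \<open>x\<close> its exponential is that of one of the four
    corners, chosen by the signs of \<open>a x\<close> and \<open>b x\<close>, so the sum over the
    corners dominates.\<close>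
  define W where "W x = 2 * ((1 / e + 6 / e\<^sup>2 + 6 / e ^ 3) * (h x * exp (a x * r + 2 * e * (\<bar>a x\<bar> + \<bar>b x\<bar>))))" for x
  have int_W: "integrable M W"
  proof -
    have "integrable M (\<lambda>x. h x * exp (a x * r + 2 * e * (\<bar>a x\<bar> + \<bar>b x\<bar>)))"
    proof (rule Bochner_Integration.integrable_bound)
      show "integrable M (\<lambda>x. f (r + 2 * e) (2 * e) x + f (r + 2 * e) (- (2 * e)) x
          + f (r - 2 * e) (2 * e) x + f (r - 2 * e) (- (2 * e)) x)"
        using e by (intro Bochner_Integration.integrable_add int_f) auto
      show "AE x in M. norm (h x * exp (a x * r + 2 * e * (\<bar>a x\<bar> + \<bar>b x\<bar>))) \<le>
        norm (f (r + 2 * e) (2 * e) x + f (r + 2 * e) (- (2 * e)) x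
          + f (r - 2 * e) (2 * e) x + f (r - 2 * e) (- (2 * e)) x)"
      proof (rule AE_I2)
        fix x assume x: "x \<in> space M"
        have nn: "0 \<le> f u v x" for u v using h[OF x] by (simp add: f_def)
        have "h x * exp (a x * r + 2 * e * (\<bar>a x\<bar> + \<bar>b x\<bar>))
          = f (if 0 \<le> a x then r + 2 * e else r - 2 * e) (if 0 \<le> b x then 2 * e else - (2 * e)) x"
          by (simp add: f_def algebra_simps abs_if)
        then show "norm (h x * exp (a x * r + 2 * e * (\<bar>a x\<bar> + \<bar>b x\<bar>))) \<le>
        norm (f (r + 2 * e) (2 * e) x + f (r + 2 * e) (- (2 * e)) x
          + f (r - 2 * e) (2 * e) x + f (r - 2 * e) (- (2 * e)) x)"
          using nn[of "r + 2 * e" "2 * e"] nn[of "r + 2 * e" "- (2 * e)"]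
            nn[of "r - 2 * e" "2 * e"] nn[of "r - 2 * e" "- (2 * e)"] by (auto split: if_splits)
      qed
    qed simp
    then show ?thesis unfolding W_def by (intro integrable_mult_right)
  qed
  define K where "K = (\<integral>x. W x \<partial>M)"
  have K: "0 \<le> K"
    unfolding K_def using e(1) h by (intro integral_nonneg_AE AE_I2) (auto simp: W_def less_imp_le)
  \<comment> \<open>The integrated convexity gap per unit of \<open>u2 - u1\<close>. Showing that
    its integral \<open>I\<close> is zero yields \<open>a = 0\<close> almost everywhere.\<close>
  define N where "N x = h x * (exp (- \<bar>b x\<bar>) * (1 - exp (- (\<bar>a x\<bar> * r / 4)))\<^sup>2)" for x
  have N_nn: "AE x in M. 0 \<le> N x"
    using h by (intro AE_I2) (simp add: N_def less_imp_le)
  have int_N: "integrable M N"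
  proof (rule Bochner_Integration.integrable_bound)
    show "integrable M (f 0 0)" by (rule int_f) simp
    show "AE x in M. norm (N x) \<le> norm (f 0 0 x)"
    proof (rule AE_I2)
      fix x assume x: "x \<in> space M"
      have "exp (- \<bar>b x\<bar>) * (1 - exp (- (\<bar>a x\<bar> * r / 4)))\<^sup>2 \<le> 1 * 1"
        using r by (intro mult_mono power_le_one) auto
      then show "norm (N x) \<le> norm (f 0 0 x)"
        using h[OF x] by (simp add: N_def f_def abs_mult)
    qed
  qed (simp add: N_def[abs_def])
  define I where "I = (\<integral>x. N x \<partial>M)"
  \<comment> \<open>The 8 combines a factor 4 from \<open>t / 2 \<le> sin t\<close>, squared, with a
    factor 2 from \<open>u1 + u2 \<le> 2\<close>.\<close>
  define k where "k = r\<^sup>2 * (1 - r\<^sup>2) / 8"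
  have k: "0 < k" using r r2 by (simp add: k_def)

  have key: "k * I \<le> K * t" if t: "0 < t" "2 * t \<le> e" for t
  proof -
    \<comment> \<open>\<open>(u1, v)\<close> is the circle point at angle \<open>- t\<close>, and
      \<open>(u2, v)\<close> is the ellipse point at the same height.\<close>
    define u1 v where "u1 = r * cos t" and "v = - (r * sin t)"
    define u2 where "u2 = r * sqrt (1 - v\<^sup>2)"
    have t1: "t \<le> 1 / 16" using t e by simp
    have cos_t: "1 / 2 \<le> cos t" "cos t \<le> 1" "0 \<le> cos (2 * t)"
      using abs_cos_minus_one_le[of t] abs_cos_minus_one_le[of "2 * t"] t1 t by auto
    have sin_t: "t / 2 \<le> sin t"
    proof -
      have "\<bar>sin t - t\<bar> \<le> inverse 2 * t\<^sup>2"
        using Maclaurin_sin_bound[of t 2] by (simp add: eval_nat_numeral sin_coeff_def)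
      moreover have "t\<^sup>2 \<le> t" using t t1 by (simp add: power2_eq_square mult_le_cancel_left1)
      ultimately show ?thesis using t unfolding abs_le_iff by (simp add: field_simps)
    qed
    have sin_2t: "0 \<le> sin (2 * t)" using sin_t t cos_t by (simp add: sin_double)
    have v0: "v < 0" using sin_t t r by (simp add: v_def)
    have uv: "u1\<^sup>2 + v\<^sup>2 = r\<^sup>2" using rsc[of t] by (simp add: u1_def v_def)
    have v1: "v\<^sup>2 \<le> r\<^sup>2" using uv by (smt (verit) zero_le_power2)
    have v2: "v\<^sup>2 < 1" using v1 r2 by simp
    have u2sq: "u2\<^sup>2 = r\<^sup>2 * (1 - v\<^sup>2)" using v2 by (simp add: u2_def power_mult_distrib)
    have "r\<^sup>2 * v\<^sup>2 < 1 * v\<^sup>2" using r2 v0 by (intro mult_strict_right_mono) auto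
    then have usq: "u1\<^sup>2 < u2\<^sup>2" using uv by (simp add: u2sq algebra_simps)
    have u1: "r / 2 \<le> u1" "0 < u1" using cos_t r mult_left_mono[OF cos_t(1), of r] by (auto simp: u1_def)
    have u2: "0 \<le> u2" "u2 \<le> r" using r v2 by (simp_all add: u2_def mult_le_cancel_left1)
    have u12: "u1 < u2" using usq u2(1) power_less_imp_less_base by blast
    have "r\<^sup>2 * (1 - v\<^sup>2) + v\<^sup>2 < 1"
    proof -
      have "r\<^sup>2 * (1 - v\<^sup>2) < 1 * (1 - v\<^sup>2)" using r2 v2 by (intro mult_strict_right_mono) auto
      then show ?thesis by simp
    qed
    then have D: "u2\<^sup>2 + v\<^sup>2 < 1" "u1\<^sup>2 + v\<^sup>2 < 1" "0\<^sup>2 + v\<^sup>2 < 1" using u2sq uv r2 v2 by simp_all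
    have gap: "k * t\<^sup>2 \<le> u2 - u1"
    proof -
      \<comment> \<open>The difference of the squares is explicit:
        \<open>r\<^sup>2 * (1 - v\<^sup>2)\<close> minus
        \<open>r\<^sup>2 - v\<^sup>2\<close>.\<close>
      have "(u2 - u1) * (u2 + u1) = r\<^sup>2 * (1 - r\<^sup>2) * (sin t)\<^sup>2"
        using uv u2sq by (simp add: v_def power2_eq_square algebra_simps)
      moreover have "(u2 - u1) * (u2 + u1) \<le> (u2 - u1) * 2"
        using u12 u2 r by (intro mult_left_mono) auto
      moreover have "r\<^sup>2 * (1 - r\<^sup>2) * (t / 2)\<^sup>2 \<le> r\<^sup>2 * (1 - r\<^sup>2) * (sin t)\<^sup>2"
        using sin_t t r2 by (intro mult_left_mono power_mono) auto
      ultimately show ?thesis by (simp add: k_def power_divide)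
    qed
    \<comment> \<open>The angles 0, \<open>t\<close> and \<open>2 * t\<close> lie on the arc where
      \<open>F = c\<close>, so the third difference reduces to \<open>F u1 v - c\<close>.\<close>
    have "- (K * t ^ 3) \<le> F u1 v - 3 * F r 0 + 3 * F (r * cos t) (r * sin t) - F (r * cos (2 * t)) (r * sin (2 * t))"
    proof -
      have "(\<integral>x. - (W x * t ^ 3) \<partial>M) \<le> (\<integral>x. f u1 v x - 3 * f r 0 x + 3 * f (r * cos t) (r * sin t) x
          - f (r * cos (2 * t)) (r * sin (2 * t)) x \<partial>M)"
      proof (rule integral_mono)
        fix x assume x: "x \<in> space M"
        have "h x * - (2 * ((1 / e + 6 / e\<^sup>2 + 6 / e ^ 3) * exp (a x * r + 2 * e * (\<bar>a x\<bar> + \<bar>b x\<bar>))) * t ^ 3)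
          \<le> h x * (exp (r * (a x * cos (- t) + b x * sin (- t))) - 3 * exp (r * (a x * cos 0 + b x * sin 0))
            + 3 * exp (r * (a x * cos t + b x * sin t)) - exp (r * (a x * cos (2 * t) + b x * sin (2 * t))))"
          using exp_circle_third_difference[OF e(1) less_imp_le[OF t(1)] t(2) r, of "a x" "b x"] h[OF x]
          by (intro mult_left_mono) (auto simp: abs_le_iff)
        then show "- (W x * t ^ 3) \<le> f u1 v x - 3 * f r 0 x + 3 * f (r * cos t) (r * sin t) x
          - f (r * cos (2 * t)) (r * sin (2 * t)) x"
          by (simp add: W_def f_def u1_def v_def algebra_simps)
      qed (use int_W int_f D rsc r2 in auto)
      also have "\<dots> = F u1 v - 3 * F r 0 + 3 * F (r * cos t) (r * sin t) - F (r * cos (2 * t)) (r * sin (2 * t))"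
        using int_f D rsc r2 by (simp add: F_def)
      finally show ?thesis using int_W by (simp add: K_def)
    qed
    moreover have "F r 0 = c" "F (r * cos t) (r * sin t) = c" "F (r * cos (2 * t)) (r * sin (2 * t)) = c"
      using r cos_t sin_t sin_2t t rsc by (auto intro!: F_circle mult_nonneg_nonneg)
    ultimately have lower: "c - K * t ^ 3 \<le> F u1 v" by linarith
    \<comment> \<open>Convexity along the horizontal chord from \<open>(0, v)\<close> to
      \<open>(u2, v)\<close>: both ends satisfy \<open>F \<le> c\<close>, so the gap at
      \<open>(u1, v)\<close> is at most \<open>u2\<close> times the deficit of \<open>F u1 v\<close>
      below \<open>c\<close>.\<close>
    have "(u2 - u1) * I = (\<integral>x. (u2 - u1) * N x \<partial>M)" by (simp add: I_def)
    also have "\<dots> \<le> (\<integral>x. u1 * f u2 v x + (u2 - u1) * f 0 v x - u2 * f u1 v x \<partial>M)"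
    proof (rule integral_mono)
      fix x assume x: "x \<in> space M"
      have "\<bar>v\<bar> \<le> 1" using v2 by (simp add: abs_square_less_1 less_imp_le)
      moreover have "u2 \<le> 1" using u2 r by simp
      ultimately have "h x * ((u2 - u1) * (exp (- \<bar>b x\<bar>) * (1 - exp (- (\<bar>a x\<bar> * r / 4)))\<^sup>2))
        \<le> h x * (u1 * exp (a x * u2 + b x * v) + (u2 - u1) * exp (b x * v) - u2 * exp (a x * u1 + b x * v))"
        using h[OF x] exp_chord_lower[OF u1(2) u12 _ r(1) u1(1), of v "b x" "a x"]
        by (intro mult_left_mono) auto
      then show "(u2 - u1) * N x \<le> u1 * f u2 v x + (u2 - u1) * f 0 v x - u2 * f u1 v x"
        by (simp add: N_def f_def algebra_simps)
    qed (use int_N int_f D in auto)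
    also have "\<dots> = u1 * F u2 v + (u2 - u1) * F 0 v - u2 * F u1 v"
      using int_f[OF D(1)] int_f[OF D(2)] int_f[OF D(3)] by (simp add: F_def)
    also have "\<dots> \<le> u1 * c + (u2 - u1) * c - u2 * (c - K * t ^ 3)"
    proof -
      have "F u2 v \<le> c" "F 0 v \<le> c"
        using F_ellipse[of u2 v] F_ellipse[of 0 v] u2 v0 D u2sq v2 by simp_all
      then show ?thesis
        using lower u1 u12 u2 by (intro diff_mono add_mono mult_left_mono) auto
    qed
    also have "\<dots> = u2 * (K * t ^ 3)" by (simp add: algebra_simps)
    also have "\<dots> \<le> 1 * (K * t ^ 3)"
      using u2 r K t by (intro mult_right_mono) auto
    finally have "(u2 - u1) * I \<le> K * t ^ 3" by simp
    moreover have "0 \<le> I" unfolding I_def by (rule integral_nonneg_AE[OF N_nn])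
    ultimately have "k * t\<^sup>2 * I \<le> K * t ^ 3"
      using gap mult_right_mono by fastforce
    then have "(k * I) * t\<^sup>2 \<le> (K * t) * t\<^sup>2" by (simp add: algebra_simps eval_nat_numeral)
    then show ?thesis using t by simp
  qed
  have "I \<le> 0"
  proof -
    have "((\<lambda>t. K * t) \<longlongrightarrow> K * 0) (at_right 0)" by (intro tendsto_intros)
    moreover have "\<forall>\<^sub>F t in at_right 0. k * I \<le> K * t"
      using key e(1) by (intro eventually_at_rightI[of 0 "e / 2"]) auto
    ultimately have "k * I \<le> K * 0"
      by (intro tendsto_lowerbound[of "\<lambda>t. K * t" _ "at_right 0"]) auto
    then show ?thesis using k by (simp add: mult_le_0_iff)
  qed
  moreover have "0 \<le> I" unfolding I_def by (rule integral_nonneg_AE[OF N_nn])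
  ultimately have "AE x in M. N x = 0"
    using integral_nonneg_eq_0_iff_AE[OF int_N N_nn] by (simp add: I_def)
  moreover have "AE x in M. N x = 0 \<longrightarrow> a x = 0"
    using h r by (intro AE_I2) (force simp: N_def)
  ultimately have a0: "AE x in M. a x = 0" by eventually_elim simp

  \<comment> \<open>\<open>(0, r)\<close>, \<open>(u, r / 2)\<close> and \<open>(r, 0)\<close> lie
    on the arc at equally spaced heights. Where \<open>a = 0\<close>, the second difference of the
    integrand is \<open>h\<close> times a perfect square.\<close>
  define u where "u = sqrt (r\<^sup>2 - (r / 2)\<^sup>2)"
  have u: "0 \<le> u" "u\<^sup>2 + (r / 2)\<^sup>2 = r\<^sup>2" by (simp_all add: u_def power_divide)
  define Q where "Q x = f 0 r x - 2 * f u (r / 2) x + f r 0 x" for x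
  have int_Q: "integrable M Q"
    unfolding Q_def using u r2 by (intro Bochner_Integration.integrable_add Bochner_Integration.integrable_diff
        integrable_mult_right int_f) auto
  have "(\<integral>x. Q x \<partial>M) = F 0 r - 2 * F u (r / 2) + F r 0"
    using u r2 int_f[of 0 r] int_f[of u "r / 2"] int_f[of r 0] by (simp add: Q_def F_def)
  also have "\<dots> = 0" using u r by (simp add: F_circle)
  finally have Q0: "(\<integral>x. Q x \<partial>M) = 0" .
  have Q_eq: "AE x in M. Q x = h x * (exp (b x * (r / 2)) - 1)\<^sup>2"
    using a0
  proof eventually_elim
    fix x assume "a x = 0"
    moreover have "exp (b x * r) = (exp (b x * (r / 2)))\<^sup>2" by (simp flip: exp_double)
    ultimately show "Q x = h x * (exp (b x * (r / 2)) - 1)\<^sup>2"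
      by (simp add: Q_def f_def power2_diff algebra_simps)
  qed
  then have "AE x in M. 0 \<le> Q x"
    using AE_space by eventually_elim (simp add: h less_imp_le)
  then have "AE x in M. Q x = 0"
    using integral_nonneg_eq_0_iff_AE[OF int_Q] Q0 by simp
  then show ?thesis
    using Q_eq a0 AE_space
  proof eventually_elim
    case (elim x)
    with h[of x] r show ?case by auto
  qed
qed

section \<open>The likelihood on whitened samples\<close>

lemma sample_density_eq:
  fixes x :: "real^'p^'n"
  shows "sample_density \<theta> \<Sigma> x = exp (- (\<Sum>i\<in>UNIV. inner_wrt \<Sigma> (x $ i - \<theta>) (x $ i - \<theta>)) / 2)
    / sqrt ((2 * pi) ^ CARD('p) * det \<Sigma>) ^ CARD('n)"
proof -
  have "(\<Prod>i\<in>UNIV. exp (- inner_wrt \<Sigma> (x $ i - \<theta>) (x $ i - \<theta>) / 2))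
      = exp (- (\<Sum>i\<in>UNIV. inner_wrt \<Sigma> (x $ i - \<theta>) (x $ i - \<theta>)) / 2)"
    by (subst exp_sum[symmetric]) (simp_all add: sum_negf sum_divide_distrib)
  then show ?thesis
    by (simp add: sample_density_def mvn_density_def inner_wrt_def prod_dividef)
qed

lemma sample_density_pos:
  assumes "\<Sigma> \<in> spd_matrices"
  shows "0 < sample_density \<theta> \<Sigma> x"
  unfolding sample_density_eq using spd_det_pos[OF assms] by simp

lemma tendsto_sample_density:
  fixes x :: "'a \<Rightarrow> real^'p^'n"
  assumes "(\<theta> \<longlongrightarrow> \<theta>0) F" "(\<Sigma> \<longlongrightarrow> \<Sigma>0) F" "(x \<longlongrightarrow> x0) F" "\<Sigma>0 \<in> spd_matrices"
  shows "((\<lambda>t. sample_density (\<theta> t) (\<Sigma> t) (x t)) \<longlongrightarrow> sample_density \<theta>0 \<Sigma>0 x0) F"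
  unfolding sample_density_eq
proof (intro tendsto_divide tendsto_exp tendsto_minus tendsto_sum tendsto_power tendsto_real_sqrt tendsto_mult
    tendsto_inner_wrt tendsto_diff tendsto_vec_nth tendsto_det tendsto_const assms)
  show "det \<Sigma>0 \<noteq> 0" by (rule spd_det_nonzero[OF assms(4)])
  show "sqrt ((2 * pi) ^ CARD('p) * det \<Sigma>0) ^ CARD('n) \<noteq> 0"
    using spd_det_pos[OF assms(4)] by simp
qed simp

text \<open>The second moments are normalised about the origin, not about the sample mean, so the
  scatter matrix still depends on \<open>y\<close>.\<close>

definition whitened :: "real^'p \<Rightarrow> real^'p^'n \<Rightarrow> bool" where
  "whitened y x \<longleftrightarrow> sqrt (real CARD('n)) *\<^sub>R sample_mean x = y \<and>
     (\<forall>a b. (\<Sum>i\<in>UNIV. x $ i $ a * x $ i $ b) = (if a = b then 1 else 0))"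

text \<open>Normalised second moments turn the part quadratic in the sample into the trace of the
  precision matrix, the same for all whitened samples. Only the linear term sees
  \<open>y\<close>.\<close>

lemma whitened_sum_inner_wrt:
  fixes x :: "real^'p^'n"
  assumes x: "whitened y x" and \<Sigma>: "\<Sigma> \<in> spd_matrices"
  shows "(\<Sum>i\<in>UNIV. inner_wrt \<Sigma> (x $ i - \<theta>) (x $ i - \<theta>))
    = trace (matrix_inv \<Sigma>) - 2 * sqrt (real CARD('n)) * inner_wrt \<Sigma> y \<theta> + real CARD('n) * inner_wrt \<Sigma> \<theta> \<theta>"
proof -
  define P where "P = matrix_inv \<Sigma>"
  have mean: "(\<Sum>i\<in>UNIV. x $ i) = sqrt (real CARD('n)) *\<^sub>R y"
    using x by (auto simp: whitened_def sample_mean_def)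
  have "(\<Sum>i\<in>UNIV. inner_wrt \<Sigma> (x $ i) (x $ i))
      = (\<Sum>i\<in>UNIV. \<Sum>a\<in>UNIV. \<Sum>b\<in>UNIV. P $ a $ b * (x $ i $ a * x $ i $ b))"
    by (simp add: inner_wrt_def P_def inner_vec_def matrix_vector_mult_def sum_distrib_left mult_ac)
  also have "\<dots> = (\<Sum>a\<in>UNIV. \<Sum>i\<in>UNIV. \<Sum>b\<in>UNIV. P $ a $ b * (x $ i $ a * x $ i $ b))"
    by (rule sum.swap)
  also have "\<dots> = (\<Sum>a\<in>UNIV. \<Sum>b\<in>UNIV. \<Sum>i\<in>UNIV. P $ a $ b * (x $ i $ a * x $ i $ b))"
    by (intro sum.cong refl sum.swap)
  also have "\<dots> = (\<Sum>a\<in>UNIV. \<Sum>b\<in>UNIV. P $ a $ b * (if a = b then 1 else 0))"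
    using x by (simp add: whitened_def flip: sum_distrib_left)
  also have "\<dots> = trace P" by (simp add: trace_def if_distrib cong: if_cong)
  finally have sq: "(\<Sum>i\<in>UNIV. inner_wrt \<Sigma> (x $ i) (x $ i)) = trace P" .
  have "inner_wrt \<Sigma> (\<Sum>i\<in>UNIV. x $ i) \<theta> = (\<Sum>i\<in>UNIV. inner_wrt \<Sigma> (x $ i) \<theta>)"
    by (simp add: inner_wrt_def inner_sum_left)
  then have lin: "(\<Sum>i\<in>UNIV. inner_wrt \<Sigma> (x $ i) \<theta>) = sqrt (real CARD('n)) * inner_wrt \<Sigma> y \<theta>"
    by (simp add: mean inner_wrt_linear)
  have "inner_wrt \<Sigma> (x $ i - \<theta>) (x $ i - \<theta>)
    = inner_wrt \<Sigma> (x $ i) (x $ i) - 2 * inner_wrt \<Sigma> (x $ i) \<theta> + inner_wrt \<Sigma> \<theta> \<theta>" for i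
    using inner_wrt_commute[OF \<Sigma>, of \<theta> "x $ i"] by (simp add: inner_wrt_linear)
  then have "(\<Sum>i\<in>UNIV. inner_wrt \<Sigma> (x $ i - \<theta>) (x $ i - \<theta>))
    = (\<Sum>i\<in>UNIV. inner_wrt \<Sigma> (x $ i) (x $ i)) - 2 * (\<Sum>i\<in>UNIV. inner_wrt \<Sigma> (x $ i) \<theta>)
      + (\<Sum>i\<in>(UNIV::'n set). inner_wrt \<Sigma> \<theta> \<theta>)"
    by (simp only: sum.distrib sum_subtractf sum_distrib_left)
  then show ?thesis
    unfolding sq lin by (simp add: P_def)
qed

text \<open>Completing the square in \<open>\<theta>\<close> gives a bound uniform in
  \<open>\<theta>\<close> and growing with the precision; this is where
  \<open>y \<bullet> y < 1\<close> will matter.\<close>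

lemma whitened_sum_inner_wrt_ge:
  fixes x :: "real^'p^'n"
  assumes x: "whitened y x" and \<Sigma>: "\<Sigma> \<in> spd_matrices"
  shows "(1 - y \<bullet> y) * trace (matrix_inv \<Sigma>) \<le> (\<Sum>i\<in>UNIV. inner_wrt \<Sigma> (x $ i - \<theta>) (x $ i - \<theta>))"
proof -
  define z where "z = sqrt (real CARD('n)) *\<^sub>R \<theta>"
  have "inner_wrt \<Sigma> (y - z) (y - z) = inner_wrt \<Sigma> y y - 2 * sqrt (real CARD('n)) * inner_wrt \<Sigma> y \<theta>
      + real CARD('n) * inner_wrt \<Sigma> \<theta> \<theta>"
    using inner_wrt_commute[OF \<Sigma>, of \<theta> y] by (simp add: z_def inner_wrt_linear algebra_simps)
  moreover have "0 \<le> inner_wrt \<Sigma> (y - z) (y - z)" by (rule inner_wrt_nonneg[OF \<Sigma>])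
  moreover have "inner_wrt \<Sigma> y y \<le> trace (matrix_inv \<Sigma>) * (y \<bullet> y)"
    unfolding inner_wrt_def by (rule spd_quadratic_le_trace[OF matrix_inv_spd[OF \<Sigma>]])
  ultimately show ?thesis
    unfolding whitened_sum_inner_wrt[OF x \<Sigma>] by (simp add: algebra_simps)
qed

text \<open>Uniformity in the parameters makes every mixture finite and continuous near such samples,
  whatever the prior.\<close>

lemma sample_density_locally_bounded:
  fixes x0 :: "real^'p^'n"
  assumes x0: "whitened y x0" and y: "y \<bullet> y < 1"
  shows "\<exists>\<delta>>0. \<exists>K. \<forall>x\<in>ball x0 \<delta>. \<forall>\<theta>. \<forall>\<Sigma>\<in>spd_matrices. sample_density \<theta> \<Sigma> x \<le> K"
proof -
  define s where "s = 1 - y \<bullet> y"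
  \<comment> \<open>Half of the bound \<open>s * \<tau>\<close> at \<open>x0\<close> survives the
    change of centre, and a shift shorter than \<open>\<delta>\<close> costs at most
    \<open>s / 4 * \<tau>\<close>, so the density decays like
    \<open>exp (- (s / 8 * \<tau>))\<close>. \<open>\<kappa>\<close> is chosen so that the
    \<open>n\<close>-th power of \<open>exp (\<kappa> * \<tau>)\<close> cancels this
    exactly.\<close>
  define \<delta> where "\<delta> = sqrt (s / 4)"
  define \<kappa> where "\<kappa> = s / (8 * real CARD('n))"
  define K where "K = (1 + fact CARD('p) * (fact CARD('p) / \<kappa> ^ CARD('p))) ^ CARD('n)"
  have s: "0 < s" and \<kappa>: "0 < \<kappa>" and \<delta>: "0 < \<delta>" using y by (simp_all add: s_def \<kappa>_def \<delta>_def)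
  have "sample_density \<theta> \<Sigma> x \<le> K" if x: "x \<in> ball x0 \<delta>" and \<Sigma>: "\<Sigma> \<in> spd_matrices" for x \<theta> \<Sigma>
  proof -
    define P where "P = matrix_inv \<Sigma>"
    define q where "q v = inner_wrt \<Sigma> v v" for v
    have P: "P \<in> spd_matrices" using matrix_inv_spd[OF \<Sigma>] by (simp add: P_def)
    define \<tau> where "\<tau> = trace P"
    have \<tau>: "0 < \<tau>" using spd_trace_pos[OF P] by (simp add: \<tau>_def)
    \<comment> \<open>Parallelogram law with one square dropped; the cost of replacing
      \<open>x\<close> by \<open>x0\<close> is free of \<open>\<theta>\<close>.\<close>
    have "q (x0 $ i - \<theta>) / 2 - q (x $ i - x0 $ i) \<le> q (x $ i - \<theta>)" for i
    proof -
      define u where "u = x $ i - \<theta>" define d where "d = x $ i - x0 $ i"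
      have "x0 $ i - \<theta> = u - d" by (simp add: u_def d_def)
      moreover have "0 \<le> q (u + d)" by (simp add: q_def inner_wrt_nonneg \<Sigma>)
      moreover have "q (u - d) + q (u + d) = 2 * q u + 2 * q d"
        by (simp add: q_def inner_wrt_linear)
      ultimately show ?thesis by (simp flip: u_def d_def)
    qed
    then have "(\<Sum>i\<in>UNIV. q (x0 $ i - \<theta>) / 2 - q (x $ i - x0 $ i)) \<le> (\<Sum>i\<in>UNIV. q (x $ i - \<theta>))"
      by (rule sum_mono)
    then have "(\<Sum>i\<in>UNIV. q (x0 $ i - \<theta>)) / 2 - (\<Sum>i\<in>UNIV. q (x $ i - x0 $ i)) \<le> (\<Sum>i\<in>UNIV. q (x $ i - \<theta>))"
      by (simp add: sum_subtractf sum_divide_distrib)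
    moreover have "s * \<tau> \<le> (\<Sum>i\<in>UNIV. q (x0 $ i - \<theta>))"
      using whitened_sum_inner_wrt_ge[OF x0 \<Sigma>] by (simp add: s_def \<tau>_def P_def q_def)
    moreover have "(\<Sum>i\<in>UNIV. q (x $ i - x0 $ i)) \<le> s / 4 * \<tau>"
    proof -
      have "(\<Sum>i\<in>UNIV. q (x $ i - x0 $ i)) \<le> (\<Sum>i\<in>UNIV. \<tau> * ((x - x0) $ i \<bullet> (x - x0) $ i))"
        unfolding q_def inner_wrt_def \<tau>_def P_def[symmetric]
        by (intro sum_mono) (simp add: spd_quadratic_le_trace[OF P])
      also have "\<dots> = \<tau> * (norm (x - x0))\<^sup>2"
        by (simp add: power2_norm_eq_inner inner_vec_def[of "x - x0"] flip: sum_distrib_left)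
      also have "\<dots> \<le> \<tau> * \<delta>\<^sup>2"
        using x \<tau> by (intro mult_left_mono power_mono) (auto simp: dist_norm norm_minus_commute)
      finally show ?thesis using s by (simp add: \<delta>_def mult.commute)
    qed
    ultimately have "s / 4 * \<tau> \<le> (\<Sum>i\<in>UNIV. q (x $ i - \<theta>))" by (simp add: algebra_simps)
    then have E: "exp (- (\<Sum>i\<in>UNIV. q (x $ i - \<theta>)) / 2) \<le> exp (- (s / 8 * \<tau>))" by (simp add: mult.commute)
    have det: "det P * det \<Sigma> = 1"
      using matrix_inv_mult(2)[OF spd_det_nonzero[OF \<Sigma>]] by (simp add: P_def flip: det_mul)
    define D where "D = (2 * pi) ^ CARD('p) * det \<Sigma>"
    have "1 \<le> (2 * pi) ^ CARD('p)" using pi_ge_two by (intro one_le_power) simp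
    then have "det \<Sigma> \<le> D" using spd_det_pos[OF \<Sigma>] by (simp add: D_def)
    moreover have "det P = 1 / det \<Sigma>" using det spd_det_pos[OF \<Sigma>] by (simp add: field_simps)
    ultimately have D: "0 < D" "1 / D \<le> det P"
      using spd_det_pos[OF \<Sigma>] by (auto intro: divide_left_mono)
    \<comment> \<open>Removes the root, so that \<open>1 / D \<le> det P\<close> and the determinant
      bound give polynomial growth in \<open>\<tau>\<close>.\<close>
    have "1 / sqrt D \<le> 1 + 1 / D"
    proof -
      have "w \<le> 1 + w\<^sup>2" for w :: real
        using sum_squares_bound[of w 1] zero_le_power2[of w] by (simp only: power_one mult_1_right)
      from this[of "1 / sqrt D"] show ?thesis using D by (simp add: power_divide)
    qed
    also have "\<dots> \<le> 1 + fact CARD('p) * \<tau> ^ CARD('p)"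
      using D(2) spd_det_le[OF P] by (simp add: \<tau>_def)
    also have "\<dots> \<le> exp (\<kappa> * \<tau>) + fact CARD('p) * (fact CARD('p) / \<kappa> ^ CARD('p) * exp (\<kappa> * \<tau>))"
      using \<kappa> \<tau> by (intro add_mono mult_left_mono power_le_exp) auto
    finally have "1 / sqrt D \<le> (1 + fact CARD('p) * (fact CARD('p) / \<kappa> ^ CARD('p))) * exp (\<kappa> * \<tau>)"
      by (simp add: algebra_simps)
    then have "(1 / sqrt D) ^ CARD('n) \<le> ((1 + fact CARD('p) * (fact CARD('p) / \<kappa> ^ CARD('p))) * exp (\<kappa> * \<tau>)) ^ CARD('n)"
      using D by (intro power_mono) auto
    also have "\<dots> = K * exp (s / 8 * \<tau>)"
      by (simp add: K_def power_mult_distrib \<kappa>_def flip: exp_of_nat_mult)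
    finally have "exp (- (\<Sum>i\<in>UNIV. q (x $ i - \<theta>)) / 2) * (1 / sqrt D) ^ CARD('n) \<le> exp (- (s / 8 * \<tau>)) * (K * exp (s / 8 * \<tau>))"
      using E D by (intro mult_mono) auto
    also have "\<dots> = K" by (simp add: mult.left_commute[of _ K] flip: exp_add)
    finally show ?thesis
      by (simp add: sample_density_eq D_def q_def power_one_over)
  qed
  then show ?thesis using \<delta> by blast
qed

section \<open>Mixtures of densities over a prior\<close>

lemma prob_measure_on_space: "prob_measure_on T G \<Longrightarrow> space G = T"
  using sets_eq_imp_space_eq[of G "restrict_space borel T"]
  by (simp add: prob_measure_on_def space_restrict_space)

lemma prob_measure_on_measurable:
  fixes f :: "'a::topological_space \<Rightarrow> 'b::topological_space"
  assumes "prob_measure_on T G" "continuous_on T f"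
  shows "f \<in> borel_measurable G"
proof -
  have "borel_measurable G = borel_measurable (restrict_space borel T)"
    using assms(1) by (intro measurable_cong_sets) (auto simp: prob_measure_on_def)
  then show ?thesis
    using borel_measurable_continuous_on_restrict[OF assms(2)] by blast
qed

lemma sample_density_measurable:
  fixes x :: "real^'p^'n"
  assumes "prob_measure_on T G" "T \<subseteq> UNIV \<times> spd_matrices"
  shows "(\<lambda>\<omega>. sample_density (fst \<omega>) (snd \<omega>) x) \<in> borel_measurable G"
  using assms(2)
  by (intro prob_measure_on_measurable[OF assms(1)])
    (auto simp: continuous_on_def intro!: tendsto_sample_density tendsto_intros)

lemma marginal_density_eq:
  "marginal_density G x = (\<integral>\<^sup>+ \<omega>. ennreal (sample_density (fst \<omega>) (snd \<omega>) x) \<partial>G)"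
  by (simp add: marginal_density_def case_prod_beta')

text \<open>Dominated convergence along sequences in the ball where the densities have a common
  bound; a constant is integrable for a probability measure.\<close>

lemma marginal_density_tendsto:
  fixes x0 :: "real^'p^'n"
  assumes G: "prob_measure_on T G" and T: "T \<subseteq> UNIV \<times> spd_matrices"
    and x0: "whitened y x0" "y \<bullet> y < 1"
  shows "(marginal_density G \<longlongrightarrow> marginal_density G x0) (at x0)"
proof -
  interpret prob_space G using G by (simp add: prob_measure_on_def)
  obtain \<delta> K where \<delta>: "0 < \<delta>"
    and K: "\<And>x \<theta> \<Sigma>. x \<in> ball x0 \<delta> \<Longrightarrow> \<Sigma> \<in> spd_matrices \<Longrightarrow> sample_density \<theta> \<Sigma> x \<le> K"
    using sample_density_locally_bounded[OF x0] by blast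
  have space: "snd \<omega> \<in> spd_matrices" if "\<omega> \<in> space G" for \<omega>
    using that T prob_measure_on_space[OF G] by auto
  have "(marginal_density G \<longlongrightarrow> marginal_density G x0) (at x0 within ball x0 \<delta>)"
    unfolding tendsto_at_iff_sequentially o_def
  proof (intro allI impI)
    fix X assume X: "\<forall>i. X i \<in> ball x0 \<delta> - {x0}" "X \<longlonglongrightarrow> x0"
    show "(\<lambda>i. marginal_density G (X i)) \<longlonglongrightarrow> marginal_density G x0"
      unfolding marginal_density_eq
    proof (rule nn_integral_dominated_convergence)
      show "AE \<omega> in G. ennreal (sample_density (fst \<omega>) (snd \<omega>) (X i)) \<le> ennreal K" for i
        using X(1) space by (intro AE_I2 ennreal_leI K) auto
      show "AE \<omega> in G. (\<lambda>i. ennreal (sample_density (fst \<omega>) (snd \<omega>) (X i)))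
          \<longlonglongrightarrow> ennreal (sample_density (fst \<omega>) (snd \<omega>) x0)"
        using X(2) space by (intro AE_I2 tendsto_ennrealI tendsto_sample_density tendsto_const) auto
      show "(\<integral>\<^sup>+ \<omega>. ennreal K \<partial>G) < \<infinity>" by (simp add: emeasure_space_1)
    qed (use sample_density_measurable[OF G T] in \<open>auto intro!: measurable_compose[OF _ measurable_ennreal]\<close>)
  qed
  then show ?thesis using \<delta> at_within_open[of x0 "ball x0 \<delta>"] by simp
qed

lemma sample_density_integrable:
  fixes x0 :: "real^'p^'n"
  assumes G: "prob_measure_on T G" and T: "T \<subseteq> UNIV \<times> spd_matrices"
    and x0: "whitened y x0" "y \<bullet> y < 1"
  shows "integrable G (\<lambda>\<omega>. sample_density (fst \<omega>) (snd \<omega>) x0)"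
proof -
  interpret prob_space G using G by (simp add: prob_measure_on_def)
  obtain \<delta> K where \<delta>: "0 < \<delta>"
    and K: "\<And>x \<theta> \<Sigma>. x \<in> ball x0 \<delta> \<Longrightarrow> \<Sigma> \<in> spd_matrices \<Longrightarrow> sample_density \<theta> \<Sigma> x \<le> K"
    using sample_density_locally_bounded[OF x0] by blast
  show ?thesis
  proof (rule integrable_const_bound[where B = K])
    show "AE \<omega> in G. norm (sample_density (fst \<omega>) (snd \<omega>) x0) \<le> K"
    proof (rule AE_I2)
      fix \<omega> assume "\<omega> \<in> space G"
      then have "snd \<omega> \<in> spd_matrices" using T prob_measure_on_space[OF G] by auto
      then show "norm (sample_density (fst \<omega>) (snd \<omega>) x0) \<le> K"
        using sample_density_pos[of "snd \<omega>" "fst \<omega>" x0] K[of x0 "snd \<omega>" "fst \<omega>"] \<delta> by simp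
    qed
  qed (rule sample_density_measurable[OF G T])
qed

lemma marginal_density_whitened:
  fixes x0 :: "real^'p^'n"
  assumes G: "prob_measure_on T G" and T: "T \<subseteq> UNIV \<times> spd_matrices"
    and x0: "whitened y x0" "y \<bullet> y < 1"
  shows "marginal_density G x0 = ennreal (\<integral>\<omega>. sample_density (fst \<omega>) (snd \<omega>) x0 \<partial>G)"
  unfolding marginal_density_eq
  using prob_measure_on_space[OF G] T
  by (intro nn_integral_eq_integral sample_density_integrable[OF G T x0] AE_I2 less_imp_le sample_density_pos) auto

text \<open>On whitened samples \<open>y\<close> acts as an exponential tilt, which is why a mixture
  is a Laplace transform in \<open>y\<close>.\<close>

lemma sample_density_whitened:
  fixes x x0 :: "real^'p^'n"
  assumes x: "whitened y x" and x0: "whitened 0 x0" and \<Sigma>: "\<Sigma> \<in> spd_matrices"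
  shows "sample_density \<theta> \<Sigma> x
    = sample_density \<theta> \<Sigma> x0 * exp (sqrt (real CARD('n)) * ((matrix_inv \<Sigma> *v \<theta>) \<bullet> y))"
proof -
  have "inner_wrt \<Sigma> 0 \<theta> = 0" "inner_wrt \<Sigma> y \<theta> = (matrix_inv \<Sigma> *v \<theta>) \<bullet> y"
    by (simp_all add: inner_wrt_def inner_commute)
  then have "- (\<Sum>i\<in>UNIV. inner_wrt \<Sigma> (x $ i - \<theta>) (x $ i - \<theta>)) / 2
    = - (\<Sum>i\<in>UNIV. inner_wrt \<Sigma> (x0 $ i - \<theta>) (x0 $ i - \<theta>)) / 2
      + sqrt (real CARD('n)) * ((matrix_inv \<Sigma> *v \<theta>) \<bullet> y)"
    unfolding whitened_sum_inner_wrt[OF x \<Sigma>] whitened_sum_inner_wrt[OF x0 \<Sigma>]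
    by (simp add: diff_divide_distrib add_divide_distrib)
  then show ?thesis
    unfolding sample_density_eq by (simp only: exp_add times_divide_eq_left)
qed

section \<open>Boundary values of the marginal densities\<close>

text \<open>A whitened sample consists of \<open>p\<close> orthonormal columns in
  \<open>n\<close>-space whose inner products with the unit vector \<open>e\<close> along (1, ...,
  1) are the coordinates of \<open>y\<close>. Such columns are built from \<open>e\<close> and
  \<open>p\<close> orthonormal vectors orthogonal to it, which fit since
  \<open>p < n\<close>.\<close>

lemma whitening_embedding:
  assumes "CARD('p::finite) < CARD('n::finite)"
  shows "\<exists>E :: real^'p \<Rightarrow> real^'p^'n. continuous_on (ball 0 1) E \<and> (\<forall>y\<in>ball 0 1. whitened y (E y))"
proof -
  define N where "N = real CARD('n)"
  obtain \<iota> :: "'p \<Rightarrow> 'n" where \<iota>: "inj \<iota>"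
    using assms inj_on_iff_card_le[of "UNIV :: 'p set" "UNIV :: 'n set"] by auto
  have "range \<iota> \<noteq> UNIV"
    using card_image[OF \<iota>] assms by auto
  then obtain i0 where i0: "i0 \<notin> range \<iota>" by blast
  define e :: "real^'n" where "e = (\<chi> i. 1 / sqrt N)"
  have ee: "e \<bullet> e = 1" by (simp add: e_def inner_vec_def N_def)
  then have nm: "norm (axis i0 1 :: real^'n) = norm e" by (simp add: norm_eq_sqrt_inner)
  \<comment> \<open>Sending a basis vector outside the range of \<open>\<iota>\<close> to
    \<open>e\<close> makes the images of the others orthonormal and orthogonal to
    \<open>e\<close>.\<close>
  obtain T :: "real^'n \<Rightarrow> real^'n" where T: "orthogonal_transformation T" "T (axis i0 1) = e"
    by (rule orthogonal_transformation_exists[OF nm])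
  define g where "g a = T (axis (\<iota> a) 1)" for a
  have inner_T: "T u \<bullet> T v = u \<bullet> v" for u v
    using T(1) by (simp add: orthogonal_transformation_def)
  have gg: "g a \<bullet> g b = (if a = b then 1 else 0)" for a b
    using \<iota> by (simp add: g_def inner_T inner_axis_axis inj_eq)
  have ge: "g a \<bullet> e = 0" for a
    using i0 by (auto simp: g_def inner_T inner_axis_axis simp flip: T(2))
  \<comment> \<open>\<open>I - \<kappa> y y\<^sup>T\<close> is the square root of \<open>I - y y\<^sup>T\<close>\<close>
  define \<kappa> where "\<kappa> y = 1 / (1 + sqrt (1 - y \<bullet> y))" for y :: "real^'p"
  define G where "G y = (\<Sum>b\<in>UNIV. y $ b *\<^sub>R g b)" for y
  define col where "col y a = y $ a *\<^sub>R e + g a - (\<kappa> y * y $ a) *\<^sub>R G y" for y a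
  have Gg: "G y \<bullet> g a = y $ a" for y a
  proof -
    have "G y \<bullet> g a = (\<Sum>b\<in>UNIV. y $ b * (if b = a then 1 else 0))"
      by (simp only: G_def inner_sum_left inner_scaleR_left gg)
    also have "\<dots> = (\<Sum>b\<in>UNIV. if b = a then y $ b else 0)" by (intro sum.cong) auto
    finally show ?thesis by simp
  qed
  have GG: "G y \<bullet> G y = y \<bullet> y" for y
  proof -
    have "G y \<bullet> G y = (\<Sum>b\<in>UNIV. y $ b * (G y \<bullet> g b))"
      by (subst (2) G_def) (simp only: inner_sum_right inner_scaleR_right)
    also have "\<dots> = y \<bullet> y" unfolding Gg by (simp add: inner_vec_def)
    finally show ?thesis .
  qed
  have Ge: "G y \<bullet> e = 0" for y by (simp add: G_def inner_sum_left ge)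
  have col_e: "col y a \<bullet> e = y $ a" for y a
    by (simp add: col_def inner_add_left inner_diff_left ee ge Ge)
  have col_col: "col y a \<bullet> col y b = (if a = b then 1 else 0)" if y: "y \<in> ball 0 1" for y a b
  proof -
    have "norm y < 1" using y by simp
    then have "y \<bullet> y < 1" by (simp add: power2_norm_eq_inner[symmetric] abs_square_less_1)
    define \<sigma> where "\<sigma> = sqrt (1 - y \<bullet> y)"
    have \<sigma>: "0 < \<sigma>" "y \<bullet> y = 1 - \<sigma>\<^sup>2" using \<open>y \<bullet> y < 1\<close> by (simp_all add: \<sigma>_def)
    have \<kappa>: "1 - 2 * \<kappa> y + (\<kappa> y)\<^sup>2 * (y \<bullet> y) = 0"
    proof -
      have "\<kappa> y * (1 + \<sigma>) = 1" using \<sigma>(1) by (simp add: \<kappa>_def flip: \<sigma>_def)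
      then show ?thesis unfolding \<sigma>(2) by algebra
    qed
    have "col y a \<bullet> col y b = (g a \<bullet> g b) + y $ a * y $ b * (1 - 2 * \<kappa> y + (\<kappa> y)\<^sup>2 * (y \<bullet> y))"
      using Gg Ge ge inner_commute[of "g a" "G y"] inner_commute[of e "G y"] inner_commute[of e "g b"]
      by (simp add: col_def inner_add_left inner_diff_left inner_add_right inner_diff_right ee GG
          power2_eq_square algebra_simps)
    then show ?thesis by (simp add: \<kappa> gg)
  qed
  define E where "E y = (\<chi> i a. col y a $ i)" for y
  have "continuous_on (ball 0 1) E"
  proof -
    have "1 + sqrt (1 - y \<bullet> y) \<noteq> 0" if "y \<in> ball 0 1" for y :: "real^'p"
    proof -
      have "y \<bullet> y \<le> 1" using that by (simp add: power2_norm_eq_inner[symmetric] abs_square_le_1)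
      then have "0 \<le> sqrt (1 - y \<bullet> y)" by simp
      then show ?thesis by linarith
    qed
    then show ?thesis
      unfolding E_def col_def \<kappa>_def G_def by (intro continuous_intros) auto
  qed
  moreover have "whitened y (E y)" if "y \<in> ball 0 1" for y
  proof -
    have "(\<Sum>i\<in>UNIV. E y $ i $ a * E y $ i $ b) = (if a = b then 1 else 0)" for a b
      using col_col[OF that, of a b] by (simp add: E_def inner_vec_def)
    moreover have "sqrt N *\<^sub>R sample_mean (E y) = y"
    proof -
      have "(sqrt N *\<^sub>R sample_mean (E y)) $ a = col y a \<bullet> e" for a
      proof -
        have "sqrt N / N = 1 / sqrt N" by (simp add: N_def real_div_sqrt field_simps)
        then show ?thesis
          by (simp add: sample_mean_def E_def e_def inner_vec_def N_def sum_divide_distrib[symmetric])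
      qed
      then show ?thesis by (simp add: vec_eq_iff col_e)
    qed
    ultimately show ?thesis by (simp add: whitened_def N_def)
  qed
  ultimately show ?thesis by blast
qed

text \<open>The scatter matrix is the identity minus \<open>y y'\<close>, with \<open>y\<close> as
  an eigenvector for the eigenvalue \<open>1 - y \<bullet> y\<close>.\<close>

lemma whitened_scatter_matrix:
  fixes x :: "real^'p^'n"
  assumes x: "whitened y x" and y: "y \<bullet> y < 1"
  shows "scatter_matrix x $ a $ b = (if a = b then 1 else 0) - y $ a * y $ b"
    and "scatter_matrix x \<in> spd_matrices"
    and "inner_wrt (scatter_matrix x) y y = y \<bullet> y / (1 - y \<bullet> y)"
proof -
  show S: "scatter_matrix x $ a $ b = (if a = b then 1 else 0) - y $ a * y $ b" for a b
    unfolding scatter_matrix_nth using x by (simp add: whitened_def)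
  have Sv: "scatter_matrix x *v v = v - (y \<bullet> v) *\<^sub>R y" for v
  proof -
    have "(scatter_matrix x *v v) $ a = v $ a - (\<Sum>b\<in>UNIV. y $ a * y $ b * v $ b)" for a
      by (simp add: matrix_vector_mult_def S left_diff_distrib sum_subtractf if_distrib[of "\<lambda>u. u * _"] cong: if_cong)
    then show ?thesis by (simp add: vec_eq_iff inner_vec_def sum_distrib_left sum_distrib_right mult_ac)
  qed
  have "0 < v \<bullet> (scatter_matrix x *v v)" if "v \<noteq> 0" for v
  proof -
    have "(y \<bullet> v)\<^sup>2 \<le> (y \<bullet> y) * (v \<bullet> v)" by (rule Cauchy_Schwarz_ineq)
    also have "\<dots> < 1 * (v \<bullet> v)" using y that by (intro mult_strict_right_mono) auto
    finally show ?thesis by (simp add: Sv inner_diff_right power2_eq_square inner_commute)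
  qed
  then have det: "det (scatter_matrix x) \<noteq> 0" by (rule det_nonzero_if_definite)
  then show "scatter_matrix x \<in> spd_matrices" by (rule scatter_matrix_spd)
  have "scatter_matrix x *v y = (1 - y \<bullet> y) *\<^sub>R y" by (simp add: Sv algebra_simps)
  then have "y = (1 - y \<bullet> y) *\<^sub>R (matrix_inv (scatter_matrix x) *v y)"
    using matrix_inv_mult_vec(2)[OF det, of y] by (simp add: matrix_vector_mult_scaleR)
  then have "y \<bullet> y = (1 - y \<bullet> y) * inner_wrt (scatter_matrix x) y y"
    unfolding inner_wrt_def by (metis inner_scaleR_right)
  then show "inner_wrt (scatter_matrix x) y y = y \<bullet> y / (1 - y \<bullet> y)"
    using y by (simp add: field_simps)
qed

section \<open>The likelihood ratio statistic near a whitened sample\<close>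

lemma tendsto_standardized:
  fixes x0 :: "real^'p^'n"
  assumes "whitened y x0"
  shows "((\<lambda>x. sqrt (real CARD('n)) *\<^sub>R sample_mean x) \<longlongrightarrow> y) (nhds x0)"
proof -
  have "((\<lambda>x. sqrt (real CARD('n)) *\<^sub>R sample_mean x) \<longlongrightarrow> sqrt (real CARD('n)) *\<^sub>R sample_mean x0) (nhds x0)"
    by (intro tendsto_intros tendsto_sample_mean filterlim_ident)
  then show ?thesis using assms by (simp add: whitened_def)
qed

lemma eventually_scatter_matrix_spd:
  fixes x0 :: "real^'p^'n"
  assumes "scatter_matrix x0 \<in> spd_matrices"
  shows "\<forall>\<^sub>F x in nhds x0. scatter_matrix x \<in> spd_matrices"
proof -
  have "((\<lambda>x. det (scatter_matrix x)) \<longlongrightarrow> det (scatter_matrix x0)) (nhds x0)"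
    by (intro tendsto_det tendsto_scatter_matrix filterlim_ident)
  then have "\<forall>\<^sub>F x in nhds x0. det (scatter_matrix x) \<noteq> 0"
    using tendsto_imp_eventually_ne spd_det_nonzero[OF assms] by blast
  then show ?thesis by eventually_elim (rule scatter_matrix_spd)
qed

text \<open>With \<open>m = (min 0 (y $ k))\<^sup>2\<close>, the upper bound from the half-space
  tends to \<open>(1 - m) / (1 - y \<bullet> y) - 1\<close>, and the strict inequality at the limit
  persists nearby.\<close>

lemma eventually_lrt_stat_le:
  fixes C :: "(real^'p) set" and x0 :: "real^'p^'n"
  assumes C: "closed C" "convex C" "cone C" "0 \<in> C" "C \<subseteq> half_space k"
    and x0: "whitened y x0" "y \<bullet> y < 1"
    and l: "y \<bullet> y - (min 0 (y $ k))\<^sup>2 < l * (1 - y \<bullet> y)"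
  shows "\<forall>\<^sub>F x in nhds x0. lrt_stat C x \<le> l"
proof -
  note S0 = whitened_scatter_matrix[OF x0]
  define Y where "Y x = sqrt (real CARD('n)) *\<^sub>R sample_mean x" for x :: "real^'p^'n"
  define U where "U x = (1 + inner_wrt (scatter_matrix x) (Y x) (Y x)) / (1 + (min 0 (Y x $ k))\<^sup>2 / scatter_matrix x $ k $ k) - 1" for x
  define m where "m = (min 0 (y $ k))\<^sup>2"
  have Skk: "0 < scatter_matrix x0 $ k $ k" by (rule spd_diag_pos[OF S0(2)])
  have Y: "(Y \<longlongrightarrow> y) (nhds x0)" using tendsto_standardized[OF x0(1)] by (simp add: Y_def[abs_def])
  have "(U \<longlongrightarrow> (1 + inner_wrt (scatter_matrix x0) y y) / (1 + m / scatter_matrix x0 $ k $ k) - 1) (nhds x0)"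
    unfolding U_def m_def
  proof (intro tendsto_diff tendsto_divide tendsto_add tendsto_const tendsto_inner_wrt tendsto_power tendsto_min
      tendsto_vec_nth tendsto_scatter_matrix Y filterlim_ident)
    have "0 \<le> (min 0 (y $ k))\<^sup>2 / scatter_matrix x0 $ k $ k" using Skk by simp
    then show "1 + (min 0 (y $ k))\<^sup>2 / scatter_matrix x0 $ k $ k \<noteq> 0" by linarith
  qed (use Skk spd_det_nonzero[OF S0(2)] in auto)
  moreover have "(1 + inner_wrt (scatter_matrix x0) y y) / (1 + m / scatter_matrix x0 $ k $ k) - 1 < l"
  proof -
    have kk: "scatter_matrix x0 $ k $ k = 1 - (y $ k)\<^sup>2" using S0(1)[of k k] by (simp add: power2_eq_square)
    have m1: "m < 1" using Skk kk by (auto simp: m_def min_def)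
    have "1 + m / scatter_matrix x0 $ k $ k = 1 / (1 - m)"
    proof (cases "y $ k < 0")
      case True
      then have "m = (y $ k)\<^sup>2" by (simp add: m_def)
      then show ?thesis using m1 by (simp add: kk field_simps)
    qed (simp add: m_def)
    moreover have "1 + inner_wrt (scatter_matrix x0) y y = 1 / (1 - y \<bullet> y)"
      using x0(2) by (simp add: S0(3) field_simps)
    moreover have "1 / (1 - y \<bullet> y) / (1 / (1 - m)) - 1 < l"
      using l m1 x0(2) unfolding m_def[symmetric] by (simp add: field_simps)
    ultimately show ?thesis by simp
  qed
  ultimately have "\<forall>\<^sub>F x in nhds x0. U x < l" by (rule order_tendstoD(2))
  with eventually_scatter_matrix_spd[OF S0(2)] show ?thesis
  proof eventually_elim
    case (elim x)
    then show ?case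
      using lrt_stat_le[OF elim(1) C] by (simp add: U_def Y_def)
  qed
qed

text \<open>The fixed vector \<open>y\<close> serves as the comparison point in \<open>C\<close>,
  because the standardised means of nearby samples may leave \<open>C\<close>. Its residual tends to
  zero.\<close>

lemma eventually_lrt_stat_gt:
  fixes C :: "(real^'p) set" and x0 :: "real^'p^'n"
  assumes C: "closed C" "convex C" "cone C" "0 \<in> C"
    and x0: "whitened y x0" "y \<bullet> y < 1"
    and y: "y \<in> C" and l: "l * (1 - y \<bullet> y) < y \<bullet> y"
  shows "\<forall>\<^sub>F x in nhds x0. l < lrt_stat C x"
proof -
  note S0 = whitened_scatter_matrix[OF x0]
  define Y where "Y x = sqrt (real CARD('n)) *\<^sub>R sample_mean x" for x :: "real^'p^'n"
  define U where "U x = (1 + inner_wrt (scatter_matrix x) (Y x) (Y x)) / (1 + inner_wrt (scatter_matrix x) (Y x - y) (Y x - y)) - 1" for x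
  have Y: "(Y \<longlongrightarrow> y) (nhds x0)" using tendsto_standardized[OF x0(1)] by (simp add: Y_def[abs_def])
  have z: "inner_wrt (scatter_matrix x0) (y - y) (y - y) = 0" by (simp add: inner_wrt_def)
  have "(U \<longlongrightarrow> (1 + inner_wrt (scatter_matrix x0) y y) / (1 + inner_wrt (scatter_matrix x0) (y - y) (y - y)) - 1) (nhds x0)"
    unfolding U_def
    by (intro tendsto_diff tendsto_divide tendsto_add tendsto_const tendsto_inner_wrt
      tendsto_scatter_matrix Y filterlim_ident spd_det_nonzero[OF S0(2)]) (use z in linarith)
  moreover have "l < (1 + inner_wrt (scatter_matrix x0) y y) / (1 + inner_wrt (scatter_matrix x0) (y - y) (y - y)) - 1"
    unfolding z S0(3) using l x0(2) by (simp add: field_simps)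
  ultimately have "\<forall>\<^sub>F x in nhds x0. l < U x" by (rule order_tendstoD(1))
  with eventually_scatter_matrix_spd[OF S0(2)] show ?thesis
  proof eventually_elim
    case (elim x)
    then show ?case
      using lrt_stat_ge[OF elim(1) C y] by (simp add: U_def Y_def)
  qed
qed

text \<open>If \<open>g x0 < f x0\<close>, continuity spreads this to a neighbourhood, which meets
  the interior of \<open>A\<close> in a nonempty open set. Such a set is not null, contradicting the
  almost everywhere statement.\<close>

lemma AE_less_imp_pointwise_le:
  fixes f g :: "'a::euclidean_space \<Rightarrow> ennreal"
  assumes f: "(f \<longlongrightarrow> f x0) (at x0)" and g: "(g \<longlongrightarrow> g x0) (at x0)"
    and AE: "AE x in lborel. g x < f x \<longrightarrow> x \<notin> A"
    and x0: "x0 \<in> closure (interior A)"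
  shows "f x0 \<le> g x0"
proof (rule ccontr)
  assume "\<not> ?thesis"
  then obtain d where d: "g x0 < d" "d < f x0" using dense not_le by metis
  have "\<forall>\<^sub>F x in at x0. g x < f x"
    using order_tendstoD(1)[OF f d(2)] order_tendstoD(2)[OF g d(1)]
    by eventually_elim simp
  then have "\<forall>\<^sub>F x in nhds x0. g x < f x"
    using d by (auto simp: eventually_at_filter elim: eventually_mono)
  then obtain U where U: "open U" "x0 \<in> U" "\<And>x. x \<in> U \<Longrightarrow> g x < f x"
    by (auto simp: eventually_nhds)
  define W where "W = U \<inter> interior A"
  have W: "open W" "W \<noteq> {}"
    using U x0 open_Int_closure_eq_empty[of U "interior A"] by (auto simp: W_def)
  have "AE x in lborel. x \<notin> W"
    using AE by eventually_elim (use U interior_subset in \<open>auto simp: W_def\<close>)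
  then have "W \<in> null_sets lborel" using W by (subst AE_iff_null_sets) auto
  then have "negligible W" using negligible_iff_null_sets null_sets_completionI by blast
  then show False using open_not_negligible W by blast
qed

text \<open>Reaches points where the defining inequality is an equality, by scaling \<open>y\<close>
  from the side on which it is strict.\<close>

lemma closure_interior_along_ray:
  fixes E :: "'a::real_normed_vector \<Rightarrow> 'b::topological_space"
  assumes E: "continuous_on (ball 0 1) E" and y: "y \<in> ball 0 1"
    and ev: "\<forall>\<^sub>F t in F. E (t *\<^sub>R y) \<in> interior A"
    and F: "F \<noteq> bot" "((\<lambda>t. t) \<longlongrightarrow> 1) F"
  shows "E y \<in> closure (interior A)"
proof (rule Lim_in_closed_set[OF closed_closure _ F(1)])
  show "\<forall>\<^sub>F t in F. E (t *\<^sub>R y) \<in> closure (interior A)"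
    using ev by eventually_elim (use closure_subset in blast)
  have "((\<lambda>t. t *\<^sub>R y) \<longlongrightarrow> 1 *\<^sub>R y) F" by (intro tendsto_intros F)
  moreover have "isCont E (1 *\<^sub>R y)"
    using E y by (simp add: continuous_on_eq_continuous_at)
  ultimately show "((\<lambda>t. E (t *\<^sub>R y)) \<longlongrightarrow> E y) F"
    using isCont_tendsto_compose[of "1 *\<^sub>R y" E] by simp
qed

section \<open>The two alternatives as closed convex cones\<close>

lemma pos_orthant_cone:
  "closed (pos_orthant :: (real^'a) set)" "convex (pos_orthant :: (real^'a) set)"
  "cone (pos_orthant :: (real^'a) set)" "(0 :: real^'a) \<in> pos_orthant" "pos_orthant \<subseteq> half_space k"
proof -
  have "(pos_orthant :: (real^'a) set) = (\<Inter>i. {\<theta>. 0 \<le> \<theta> $ i})" by (auto simp: pos_orthant_def)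
  moreover have "closed (\<Inter>i. {\<theta> :: real^'a. 0 \<le> \<theta> $ i})"
    by (intro closed_INT ballI closed_Collect_le continuous_intros)
  ultimately show "closed (pos_orthant :: (real^'a) set)" by simp
  show "convex (pos_orthant :: (real^'a) set)" by (auto simp: convex_def pos_orthant_def)
qed (auto simp: cone_def pos_orthant_def half_space_def)

lemma half_space_cone:
  "closed (half_space k)" "convex (half_space k)" "cone (half_space k)" "0 \<in> half_space k"
proof -
  show "closed (half_space k)" unfolding half_space_def by (intro closed_Collect_le continuous_intros)
  show "convex (half_space k)" by (auto simp: convex_def half_space_def)
qed (auto simp: cone_def half_space_def)

theorem theorem3p2:
  fixes C :: "(real^'p) set" and k :: 'p and \<alpha> l :: real
  assumes "CARD('p) \<ge> 2"
    and "CARD('n::finite) > CARD('p)"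
    and "C = pos_orthant \<or> C = half_space k"
    and "0 < \<alpha>" and "\<alpha> < 1"
    and "l > 0"
    and "(SUP \<Sigma>\<in>spd_matrices.
            measure (sample_law 0 \<Sigma>) {x :: real^'p^'n. lrt_stat C x \<ge> l}) = \<alpha>"
  shows "\<not> proper_bayes_test C {x :: real^'p^'n. lrt_stat C x \<le> l}"
proof
  assume "proper_bayes_test C {x :: real^'p^'n. lrt_stat C x \<le> l}"
  define A where "A = {x :: real^'p^'n. lrt_stat C x \<le> l}"
  define T0 where "T0 = {0 :: real^'p} \<times> (spd_matrices :: (real^'p^'p) set)"
  define T1 where "T1 = (C - {0}) \<times> (spd_matrices :: (real^'p^'p) set)"
  obtain G0 G1 c where G0: "prob_measure_on T0 G0" and G1: "prob_measure_on T1 G1" and c: "0 < c"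
    and AE: "AE x :: real^'p^'n in lborel.
        (ennreal c * marginal_density G0 x < marginal_density G1 x \<longrightarrow> x \<notin> A) \<and>
        (marginal_density G1 x < ennreal c * marginal_density G0 x \<longrightarrow> x \<in> A)"
    using \<open>proper_bayes_test C _\<close> unfolding proper_bayes_test_def A_def T0_def T1_def by auto
  have T: "T0 \<subseteq> UNIV \<times> spd_matrices" "T1 \<subseteq> UNIV \<times> spd_matrices" by (auto simp: T0_def T1_def)
  have C: "closed C" "convex C" "cone C" "0 \<in> C" and CH: "C \<subseteq> half_space k"
    using assms(3) pos_orthant_cone half_space_cone by auto
  obtain E :: "real^'p \<Rightarrow> real^'p^'n" where
    E: "continuous_on (ball 0 1) E" "\<And>y. y \<in> ball 0 1 \<Longrightarrow> whitened y (E y)"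
    using whitening_embedding assms(2) by blast
  have ball: "y \<in> ball 0 1 \<longleftrightarrow> y \<bullet> y < 1" for y :: "real^'p"
    by (simp add: power2_norm_eq_inner[symmetric] abs_square_less_1)
  have interior: "x \<in> interior {x. P x}" if "\<forall>\<^sub>F x in nhds x. P x" for P and x :: "real^'p^'n"
    using that by (auto simp: eventually_nhds intro: interiorI)
  have lim1: "(marginal_density G1 \<longlongrightarrow> marginal_density G1 (E y)) (at (E y))"
    and lim0: "((\<lambda>x. ennreal c * marginal_density G0 x) \<longlongrightarrow> ennreal c * marginal_density G0 (E y)) (at (E y))"
    if "y \<in> ball 0 1" for y
    using marginal_density_tendsto[OF G1 T(2) E(2)[OF that]] marginal_density_tendsto[OF G0 T(1) E(2)[OF that]] that ball
    by (auto intro: ennreal_tendsto_cmult)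

  have accept: "marginal_density G1 (E y) \<le> ennreal c * marginal_density G0 (E y)"
    if y: "y \<in> ball 0 1" and le: "y \<bullet> y - (min 0 (y $ k))\<^sup>2 \<le> l * (1 - y \<bullet> y)" for y
  proof (rule AE_less_imp_pointwise_le[where A = A])
    \<comment> \<open>Shrinking \<open>y\<close> scales the left side of \<open>le\<close> by
      \<open>t\<^sup>2\<close>, while the right side gains \<open>l * (1 - t\<^sup>2)\<close> beyond
      that scaling, so the inequality becomes strict.\<close>
    have "\<forall>\<^sub>F t in at_left 1. E (t *\<^sub>R y) \<in> interior A"
    proof (rule eventually_at_leftI[of 0])
      fix t :: real assume "t \<in> {0<..<1}"
      then have t: "0 < t" "t\<^sup>2 < 1" by (auto simp: power_less_one_iff abs_square_less_1)
      have "t\<^sup>2 * (y \<bullet> y) \<le> 1 * (y \<bullet> y)" using t by (intro mult_right_mono) auto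
      then have ty: "t *\<^sub>R y \<in> ball 0 1" using y unfolding ball by (simp add: power2_eq_square)
      have "min 0 (t * y $ k) = t * min 0 (y $ k)" using t by (simp add: min_def zero_le_mult_iff)
      then have "t *\<^sub>R y \<bullet> t *\<^sub>R y - (min 0 ((t *\<^sub>R y) $ k))\<^sup>2 = t\<^sup>2 * (y \<bullet> y - (min 0 (y $ k))\<^sup>2)"
        by (simp add: power_mult_distrib power2_eq_square algebra_simps)
      also have "\<dots> \<le> t\<^sup>2 * (l * (1 - y \<bullet> y))" by (intro mult_left_mono le) simp
      also have "\<dots> < l * (1 - t *\<^sub>R y \<bullet> t *\<^sub>R y)"
        using mult_strict_left_mono[OF t(2) assms(6)] by (simp add: power2_eq_square algebra_simps)
      finally show "E (t *\<^sub>R y) \<in> interior A"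
        unfolding A_def by (intro interior eventually_lrt_stat_le[OF C CH E(2)[OF ty] ty[unfolded ball]])
    qed simp
    then show "E y \<in> closure (interior A)"
      by (rule closure_interior_along_ray[OF E(1) y]) auto
  qed (use lim1[OF y] lim0[OF y] AE in auto)

  have reject: "ennreal c * marginal_density G0 (E y) \<le> marginal_density G1 (E y)"
    if y: "y \<in> ball 0 1" and yC: "y \<in> C" and ge: "l * (1 - y \<bullet> y) \<le> y \<bullet> y" for y
  proof (rule AE_less_imp_pointwise_le[where A = "- A"])
    have "((\<lambda>t. t *\<^sub>R y) \<longlongrightarrow> 1 *\<^sub>R y) (at_right 1)" by (intro tendsto_intros)
    then have "\<forall>\<^sub>F t in at_right 1. t *\<^sub>R y \<in> ball 0 1"
      by (rule topological_tendstoD) (use y in auto)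
    moreover have "\<forall>\<^sub>F t in at_right (1::real). 1 < t" by (rule eventually_at_right_less)
    \<comment> \<open>Here \<open>y\<close> is stretched instead; the cone property keeps it in
      \<open>C\<close>, and the unit ball is open.\<close>
    ultimately have "\<forall>\<^sub>F t in at_right 1. E (t *\<^sub>R y) \<in> interior (- A)"
    proof eventually_elim
      case (elim t)
      then have t: "1 < t\<^sup>2" by (simp add: power2_eq_square less_1_mult)
      have "l * (1 - t *\<^sub>R y \<bullet> t *\<^sub>R y) < t\<^sup>2 * (l * (1 - y \<bullet> y))"
        using mult_strict_left_mono[OF t assms(6)] by (simp add: power2_eq_square algebra_simps)
      also have "\<dots> \<le> t\<^sup>2 * (y \<bullet> y)" by (intro mult_left_mono ge) simp
      also have "\<dots> = t *\<^sub>R y \<bullet> t *\<^sub>R y" by (simp add: power2_eq_square)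
      finally have "\<forall>\<^sub>F x in nhds (E (t *\<^sub>R y)). l < lrt_stat C x"
        using elim(2) by (intro eventually_lrt_stat_gt[OF C E(2)[OF elim(1)] elim(1)[unfolded ball]]
            mem_cone[OF C(3) yC]) auto
      then have "\<forall>\<^sub>F x in nhds (E (t *\<^sub>R y)). x \<in> - A"
        by eventually_elim (simp add: A_def)
      from interior[OF this] show ?case unfolding Collect_mem_eq .
    qed
    then show "E y \<in> closure (interior (- A))"
      by (rule closure_interior_along_ray[OF E(1) y]) auto
  qed (use lim1[OF y] lim0[OF y] AE in auto)

  define N where "N = real CARD('n)"
  define h where "h \<omega> = sample_density (fst \<omega>) (snd \<omega>) (E 0)" for \<omega>
  define \<eta> where "\<eta> \<omega> = matrix_inv (snd \<omega>) *v fst \<omega>" for \<omega> :: "(real^'p) \<times> (real^'p^'p)"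
  define F where "F y = (\<integral>\<omega>. h \<omega> * exp (sqrt N * (\<eta> \<omega> \<bullet> y)) \<partial>G1)" for y
  \<comment> \<open>Under the null prior \<open>\<theta> = 0\<close>, so \<open>\<eta>\<close>
    vanishes and the scaled null mixture has this value at every \<open>E y\<close>.\<close>
  define c0 where "c0 = c * (\<integral>\<omega>. h \<omega> \<partial>G0)"
  have space0: "\<omega> \<in> space G0 \<Longrightarrow> \<omega> \<in> T0" and space1: "\<omega> \<in> space G1 \<Longrightarrow> \<omega> \<in> T1" for \<omega>
    using prob_measure_on_space[OF G0] prob_measure_on_space[OF G1] by auto
  have dens: "sample_density (fst \<omega>) (snd \<omega>) (E y) = h \<omega> * exp (sqrt N * (\<eta> \<omega> \<bullet> y))"
    if "y \<in> ball 0 1" "snd \<omega> \<in> spd_matrices" for y \<omega>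
    unfolding h_def \<eta>_def N_def using sample_density_whitened[OF E(2)[OF that(1)] E(2) that(2)] by simp
  have h_pos: "0 < h \<omega>" if "snd \<omega> \<in> spd_matrices" for \<omega>
    unfolding h_def by (rule sample_density_pos[OF that])
  have int: "integrable G1 (\<lambda>\<omega>. h \<omega> * exp (sqrt N * (\<eta> \<omega> \<bullet> y)))"
    and marg1: "marginal_density G1 (E y) = ennreal (F y)"
    and marg0: "ennreal c * marginal_density G0 (E y) = ennreal c0"
    if y: "y \<in> ball 0 1" for y
  proof -
    have eq1: "sample_density (fst \<omega>) (snd \<omega>) (E y) = h \<omega> * exp (sqrt N * (\<eta> \<omega> \<bullet> y))" if "\<omega> \<in> space G1" for \<omega>
      using space1[OF that] by (intro dens y) (auto simp: T1_def)
    have eq0: "sample_density (fst \<omega>) (snd \<omega>) (E y) = h \<omega>" if "\<omega> \<in> space G0" for \<omega>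
      using space0[OF that] dens[OF y, of \<omega>] by (auto simp: T0_def \<eta>_def)
    show "integrable G1 (\<lambda>\<omega>. h \<omega> * exp (sqrt N * (\<eta> \<omega> \<bullet> y)))"
      using sample_density_integrable[OF G1 T(2) E(2)[OF y]] y ball
      by (simp add: eq1 cong: Bochner_Integration.integrable_cong)
    show "marginal_density G1 (E y) = ennreal (F y)"
      using marginal_density_whitened[OF G1 T(2) E(2)[OF y]] y ball
      by (simp add: eq1 F_def cong: Bochner_Integration.integral_cong)
    have "marginal_density G0 (E y) = ennreal (\<integral>\<omega>. h \<omega> \<partial>G0)"
      using marginal_density_whitened[OF G0 T(1) E(2)[OF y]] y ball
      by (simp add: eq0 cong: Bochner_Integration.integral_cong)
    then show "ennreal c * marginal_density G0 (E y) = ennreal c0"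
      using c by (simp add: c0_def ennreal_mult')
  qed
  have F_nonneg: "0 \<le> F y" for y
    unfolding F_def using h_pos space1 by (intro Bochner_Integration.integral_nonneg) (auto simp: T1_def less_imp_le)
  have c0: "0 \<le> c0"
    unfolding c0_def using h_pos space0 c
    by (intro mult_nonneg_nonneg Bochner_Integration.integral_nonneg) (auto simp: T0_def less_imp_le)

  \<comment> \<open>At a whitened sample with \<open>y\<close> in \<open>C\<close> the statistic is
    \<open>y \<bullet> y / (1 - y \<bullet> y)\<close>, which equals \<open>l\<close> on the sphere
    of radius \<open>r\<close>.\<close>
  define r where "r = sqrt (l / (1 + l))"
  have r2: "r\<^sup>2 = l / (1 + l)" using assms(6) by (simp add: r_def)
  have r: "0 < r" "r < 1" using assms(6) by (simp_all add: r_def)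
  have rl: "l * (1 - r\<^sup>2) = r\<^sup>2" using assms(6) by (simp add: r2 field_simps)

  have rigid: "AE \<omega> in G1. \<eta> \<omega> $ j = 0 \<and> \<eta> \<omega> $ k = 0" if jk: "j \<noteq> k" for j
  proof -
    \<comment> \<open>The quadrant \<open>u, v \<ge> 0\<close> of this plane lies in either cone.
      For \<open>v \<le> 0\<close> only acceptance is used, which rests on
      \<open>C \<subseteq> half_space k\<close>, so both alternatives are treated at once.\<close>
    define Y where "Y u v = axis j u + axis k v" for u v :: real
    have YY: "Y u v \<bullet> Y u v = u\<^sup>2 + v\<^sup>2" for u v
      using jk by (simp add: Y_def inner_add_left inner_add_right inner_axis_axis power2_eq_square)
    have Yk: "Y u v $ k = v" for u v using jk by (simp add: Y_def axis_def)
    have YC: "Y u v \<in> C" if "0 \<le> u" "0 \<le> v" for u v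
      using assms(3) that by (auto simp: pos_orthant_def half_space_def Y_def axis_def)
    have FY: "sqrt N * \<eta> \<omega> $ j * u + sqrt N * \<eta> \<omega> $ k * v = sqrt N * (\<eta> \<omega> \<bullet> Y u v)" for \<omega> u v
      by (simp add: Y_def inner_add_right inner_axis algebra_simps)
    have meas: "(\<lambda>\<omega>. sqrt N * \<eta> \<omega> $ i) \<in> borel_measurable G1" for i
    proof (rule prob_measure_on_measurable[OF G1])
      show "continuous_on T1 (\<lambda>\<omega>. sqrt N * \<eta> \<omega> $ i)"
        unfolding \<eta>_def continuous_on_def
        by (intro ballI tendsto_mult tendsto_const tendsto_vec_nth tendsto_matrix_inv_mult_vec spd_det_nonzero
            tendsto_fst[OF tendsto_ident_at] tendsto_snd[OF tendsto_ident_at]) (auto simp: T1_def)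
    qed
    have "AE \<omega> in G1. sqrt N * \<eta> \<omega> $ j = 0 \<and> sqrt N * \<eta> \<omega> $ k = 0"
    proof (rule Laplace_transform_rigidity[where h = h and c = c0, OF meas meas _ _ _ r])
      show "h \<in> borel_measurable G1"
        using sample_density_measurable[OF G1 T(2)] by (simp add: h_def[abs_def])
      show "0 < h \<omega>" if "\<omega> \<in> space G1" for \<omega>
        using space1[OF that] by (intro h_pos) (auto simp: T1_def)
      show "integrable G1 (\<lambda>\<omega>. h \<omega> * exp (sqrt N * \<eta> \<omega> $ j * u + sqrt N * \<eta> \<omega> $ k * v))"
        if "u\<^sup>2 + v\<^sup>2 < 1" for u v
        unfolding FY using that by (intro int) (simp only: ball YY)
      show "(\<integral>\<omega>. h \<omega> * exp (sqrt N * \<eta> \<omega> $ j * u + sqrt N * \<eta> \<omega> $ k * v) \<partial>G1) = c0"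
        if uv: "0 \<le> u" "0 \<le> v" "u\<^sup>2 + v\<^sup>2 = r\<^sup>2" for u v
      proof -
        have y: "Y u v \<in> ball 0 1" unfolding ball YY uv(3) r2 using assms(6) by simp
        have "F (Y u v) \<le> c0"
          using accept[OF y] uv c0 unfolding YY Yk marg1[OF y] marg0[OF y] by (simp add: rl)
        moreover have "c0 \<le> F (Y u v)"
          using reject[OF y YC[OF uv(1,2)]] uv F_nonneg unfolding YY marg1[OF y] marg0[OF y] by (simp add: rl)
        ultimately show ?thesis unfolding FY by (simp add: F_def)
      qed
      show "(\<integral>\<omega>. h \<omega> * exp (sqrt N * \<eta> \<omega> $ j * u + sqrt N * \<eta> \<omega> $ k * v) \<partial>G1) \<le> c0"
        if uv: "0 \<le> u" "v \<le> 0" "u\<^sup>2 \<le> r\<^sup>2 * (1 - v\<^sup>2)" "u\<^sup>2 + v\<^sup>2 < 1" for u v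
      proof -
        have y: "Y u v \<in> ball 0 1" using uv(4) by (simp only: ball YY)
        \<comment> \<open>Substituting \<open>r\<^sup>2\<close> turns the ellipse into the
          acceptance condition, in which \<open>v \<le> 0\<close> cancels \<open>v\<^sup>2\<close>
          from \<open>y \<bullet> y\<close>.\<close>
        have "u\<^sup>2 * (1 + l) \<le> l * (1 - v\<^sup>2)"
          using uv(3) assms(6) by (simp add: r2 field_simps)
        then have "u\<^sup>2 \<le> l * (1 - (u\<^sup>2 + v\<^sup>2))" by (simp add: algebra_simps)
        then have "F (Y u v) \<le> c0"
          using accept[OF y] uv(2) c0 unfolding YY Yk marg1[OF y] marg0[OF y] by simp
        then show ?thesis unfolding FY by (simp add: F_def)
      qed
    qed
    then show ?thesis by (simp add: N_def)
  qed
  have "AE \<omega> in G1. \<eta> \<omega> $ i = 0" for i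
  proof (cases "i = k")
    case True
    \<comment> \<open>The coordinate \<open>k\<close> is covered through any other index, and one
      exists because the dimension is at least 2.\<close>
    have "\<exists>j. j \<noteq> k"
    proof (rule ccontr)
      assume "\<not> ?thesis"
      then have "(UNIV :: 'p set) = {k}" by auto
      then have "CARD('p) = 1" by (metis card.empty card.insert One_nat_def empty_iff finite.emptyI)
      then show False using assms(1) by simp
    qed
    then obtain j where "j \<noteq> k" by blast
    from rigid[OF this] show ?thesis by eventually_elim (simp add: True)
  next
    case False
    from rigid[OF this] show ?thesis by eventually_elim simp
  qed
  then have "AE \<omega> in G1. \<forall>i. \<eta> \<omega> $ i = 0" by (simp add: AE_all_countable)
  \<comment> \<open>\<open>\<theta>\<close> is recovered from \<open>\<eta>\<close> by applying the
    covariance matrix, so it would be 0 almost surely, outside the support of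
    \<open>G1\<close>.\<close>
  then have contr: "AE \<omega> in G1. False"
    using AE_space
  proof eventually_elim
    case (elim \<omega>)
    then have "\<eta> \<omega> = 0" by (simp add: vec_eq_iff)
    moreover have "snd \<omega> \<in> spd_matrices" "fst \<omega> \<noteq> 0" using space1[OF elim(2)] by (auto simp: T1_def)
    ultimately show False
      using matrix_inv_mult_vec(1)[OF spd_det_nonzero, of "snd \<omega>" "fst \<omega>"] by (simp add: \<eta>_def)
  qed
  interpret prob_space G1 using G1 by (simp add: prob_measure_on_def)
  show False using contr by simp
qed

end
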